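(* Suppose that the contractive weighted shift $S_{\boldsymbol{\lambda}}$ on the directed tree $\mathcal{T}=(V,E)$ is not of class $C_{\cdot0}$. Then $\mathcal{T}$ has no root, and the isometric asymptote $U_*$ of $S_{\boldsymbol{\lambda}}^*$ acts as follows: $$U_*h_u=\frac{\sqrt{a_u}}{\sqrt{a_{\mathrm{par}(u)}}}\cdot h_{\mathrm{par}(u)}\qquad(u\in V),$$ where $$0\neq h_u=\sum_{v\in\mathrm{Gen}(u)}\prod_{j=0}^\infty\lambda_{\mathrm{par}^j(v)}\cdot e_v\in\ell^2(V),\qquad a_u=\|h_u\|^2=\sum_{v\in\mathrm{Gen}(u)}\prod_{j=0}^\infty\lambda_{\mathrm{par}^j(v)}^2\in(0,1].$$ Moreover, $U_*$ is unitarily equivalent to the simple unilateral shift operator if there is a last level (i.e. $\mathrm{Chi}(\mathrm{Gen}(u))=\emptyset$ for some $u\in V$), and to the simple bilateral shift operator otherwise.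
   Context: A directed tree $\mathcal{T}=(V,E)$ consists of a non-empty vertex set $V$ and an edge set $E\subseteq V\times V\setminus\{(v,v)\colon v\in V\}$ such that there are no directed circuits, the underlying undirected graph is connected, and each vertex $v$ has at most one parent, i.e. at most one $u$ with $(u,v)\in E$; this $u$ is denoted $\mathrm{par}(v)$. A vertex without a parent is a root; there is at most one. $V^\circ$ is $V$ minus the root if a root exists, and $V^\circ=V$ otherwise. $\mathrm{Chi}(u)=\{v\colon(u,v)\in E\}$; $\mathrm{Chi}(W)=\bigcup_{v\in W}\mathrm{Chi}(v)$, $\mathrm{Chi}^0(W)=W$, $\mathrm{Chi}^{n+1}(W)=\mathrm{Chi}(\mathrm{Chi}^n(W))$, $\mathrm{Chi}^n(u)=\mathrm{Chi}^n(\{u\})$; $\mathrm{par}^k$ is the $k$-fold iterate of $\mathrm{par}$ where defined, $\mathrm{par}^0$ the identity. In a rootless tree, $\mathrm{Gen}(u)=\bigcup_{n=0}^\infty\mathrm{Chi}^n(\mathrm{par}^n(u))$ is the generation (level) of $u$. $\ell^2(V)$ is the complex Hilbert space of square-summable functions on $V$ with orthonormal basis $\{e_u\}_{u\in V}$. Given weights $\boldsymbol{\lambda}=\{\lambda_v\colon v\in V^\circ\}\subseteq(0,\infty)$ with $\sup_{u\in V}\sum_{v\in\mathrm{Chi}(u)}\lambda_v^2<\infty$, the weighted shift $S_{\boldsymbol{\lambda}}$ on $\mathcal{T}$ is the bounded operator on $\ell^2(V)$ with $S_{\boldsymbol{\lambda}}e_u=\sum_{v\in\mathrm{Chi}(u)}\lambda_ve_v$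 (all weights are assumed positive). It is contractive if $\|S_{\boldsymbol{\lambda}}\|\le1$. A contraction $T\in\mathcal{B}(\mathcal{H})$ is of class $C_{\cdot0}$ if $\|T^{*n}h\|\to0$ for all $h\in\mathcal{H}$. Let $A_*=\lim_nS_{\boldsymbol{\lambda}}^nS_{\boldsymbol{\lambda}}^{*n}$ (strong operator topology) and $\mathcal{H}_0^*=\ker A_*$. The isometric asymptote $U_*$ of $S_{\boldsymbol{\lambda}}^*$ is the unique isometry on $(\mathcal{H}_0^* )^\perp$, the closure of $\mathrm{ran}(A_* )$, with $A_*^{1/2}S_{\boldsymbol{\lambda}}^*=U_*A_*^{1/2}$. The simple bilateral shift is $Se_n=e_{n+1}$ on $\ell^2(\mathbb{Z})$; the simple unilateral shift is $S^+e_k=e_{k+1}$ on $\ell^2(\mathbb{N}_0)$ (multiplicity one). *)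

theory Defs
  imports "HOL-Analysis.Analysis"
begin

section \<open>The complex Hilbert space of square-summable functions\<close>

typedef 'a ell2 = "{f :: 'a \<Rightarrow> complex. (\<lambda>v. (cmod (f v))\<^sup>2) summable_on UNIV}"
  by (rule exI[of _ "\<lambda>_. 0"]) simp

setup_lifting type_definition_ell2

lemma Rep_ell2_summable: "(\<lambda>v. (cmod (Rep_ell2 f v))\<^sup>2) summable_on UNIV"
  using Rep_ell2[of f] by simp

lemma square_summable_add:
  fixes f g :: "'a \<Rightarrow> complex"
  assumes "(\<lambda>v. (cmod (f v))\<^sup>2) summable_on UNIV" "(\<lambda>v. (cmod (g v))\<^sup>2) summable_on UNIV"
  shows "(\<lambda>v. (cmod (f v + g v))\<^sup>2) summable_on UNIV"
proof (rule summable_on_comparison_test)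
  show "(\<lambda>v. 2 * ((cmod (f v))\<^sup>2 + (cmod (g v))\<^sup>2)) summable_on UNIV"
    by (intro summable_on_cmult_right summable_on_add assms)
  fix v
  have "(cmod (f v + g v))\<^sup>2 \<le> (cmod (f v) + cmod (g v))\<^sup>2"
    by (intro power_mono norm_triangle_ineq) auto
  also have "\<dots> \<le> 2 * ((cmod (f v))\<^sup>2 + (cmod (g v))\<^sup>2)"
    using sum_squares_bound[of "cmod (f v)" "cmod (g v)"] by (simp add: power2_sum)
  finally show "(cmod (f v + g v))\<^sup>2 \<le> 2 * ((cmod (f v))\<^sup>2 + (cmod (g v))\<^sup>2)" .
qed simp

lemma square_summable_cmult:
  fixes f :: "'a \<Rightarrow> complex"
  assumes "(\<lambda>v. (cmod (f v))\<^sup>2) summable_on UNIV"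
  shows "(\<lambda>v. (cmod (c * f v))\<^sup>2) summable_on UNIV"
  using summable_on_cmult_right[OF assms, of "(cmod c)\<^sup>2"]
  by (simp add: norm_mult power_mult_distrib)

lemma square_summable_product:
  fixes f g :: "'a \<Rightarrow> complex"
  assumes "(\<lambda>v. (cmod (f v))\<^sup>2) summable_on UNIV" "(\<lambda>v. (cmod (g v))\<^sup>2) summable_on UNIV"
  shows "(\<lambda>v. f v * cnj (g v)) summable_on UNIV"
proof -
  have "(\<lambda>v. norm (f v * cnj (g v))) summable_on UNIV"
  proof (rule summable_on_comparison_test)
    show "(\<lambda>v. (cmod (f v))\<^sup>2 + (cmod (g v))\<^sup>2) summable_on UNIV"
      by (intro summable_on_add assms)
    fix v
    have "2 * (cmod (f v) * cmod (g v)) \<le> (cmod (f v))\<^sup>2 + (cmod (g v))\<^sup>2"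
      using sum_squares_bound[of "cmod (f v)" "cmod (g v)"] by simp
    moreover have "0 \<le> cmod (f v) * cmod (g v)" by simp
    ultimately have "cmod (f v) * cmod (g v) \<le> (cmod (f v))\<^sup>2 + (cmod (g v))\<^sup>2" by linarith
    then show "norm (f v * cnj (g v)) \<le> (cmod (f v))\<^sup>2 + (cmod (g v))\<^sup>2"
      by (simp add: norm_mult)
  qed simp
  then show ?thesis
    by (rule Infinite_Sum.abs_summable_summable)
qed

text \<open>The inner product is linear in its first argument.\<close>

definition cinner :: "'a ell2 \<Rightarrow> 'a ell2 \<Rightarrow> complex" where
  "cinner f g = (\<Sum>\<^sub>\<infinity>v. Rep_ell2 f v * cnj (Rep_ell2 g v))"

lift_definition scaleC :: "complex \<Rightarrow> 'a ell2 \<Rightarrow> 'a ell2"  (infixr \<open>*\<^sub>C\<close> 75)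
  is "\<lambda>c f v. c * f v"
  by (rule square_summable_cmult)

instantiation ell2 :: (type) real_vector
begin

lift_definition zero_ell2 :: "'a ell2" is "\<lambda>_. 0" by simp

lift_definition plus_ell2 :: "'a ell2 \<Rightarrow> 'a ell2 \<Rightarrow> 'a ell2" is "\<lambda>f g v. f v + g v"
  by (rule square_summable_add)

lift_definition uminus_ell2 :: "'a ell2 \<Rightarrow> 'a ell2" is "\<lambda>f v. - f v" by simp

lift_definition minus_ell2 :: "'a ell2 \<Rightarrow> 'a ell2 \<Rightarrow> 'a ell2" is "\<lambda>f g v. f v - g v"
proof -
  fix f g :: "'a \<Rightarrow> complex"
  assume "(\<lambda>v. (cmod (f v))\<^sup>2) summable_on UNIV" "(\<lambda>v. (cmod (g v))\<^sup>2) summable_on UNIV"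
  then show "(\<lambda>v. (cmod (f v - g v))\<^sup>2) summable_on UNIV"
    using square_summable_add[of f "\<lambda>v. - g v"] by simp
qed

lift_definition scaleR_ell2 :: "real \<Rightarrow> 'a ell2 \<Rightarrow> 'a ell2" is "\<lambda>r f v. complex_of_real r * f v"
  by (rule square_summable_cmult)

instance
proof
  fix f g h :: "'a ell2" and r s :: real
  show "f + g + h = f + (g + h)" by transfer (simp add: add.assoc)
  show "f + g = g + f" by transfer (simp add: add.commute)
  show "0 + f = f" by transfer simp
  show "- f + f = 0" by transfer simp
  show "f - g = f + - g" by transfer simp
  show "r *\<^sub>R (f + g) = r *\<^sub>R f + r *\<^sub>R g" by transfer (simp add: algebra_simps)
  show "(r + s) *\<^sub>R f = r *\<^sub>R f + s *\<^sub>R f" by transfer (simp add: algebra_simps)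
  show "r *\<^sub>R s *\<^sub>R f = (r * s) *\<^sub>R f" by transfer (simp add: algebra_simps)
  show "1 *\<^sub>R f = f" by transfer simp
qed

end

instantiation ell2 :: (type) real_inner
begin

definition inner_ell2 :: "'a ell2 \<Rightarrow> 'a ell2 \<Rightarrow> real" where
  "inner_ell2 f g = Re (cinner f g)"

definition norm_ell2 :: "'a ell2 \<Rightarrow> real" where
  "norm_ell2 f = sqrt (\<Sum>\<^sub>\<infinity>v. (cmod (Rep_ell2 f v))\<^sup>2)"

definition dist_ell2 :: "'a ell2 \<Rightarrow> 'a ell2 \<Rightarrow> real" where
  "dist_ell2 f g = norm (f - g)"

definition sgn_ell2 :: "'a ell2 \<Rightarrow> 'a ell2" where
  "sgn_ell2 f = f /\<^sub>R norm f"

definition uniformity_ell2 :: "('a ell2 \<times> 'a ell2) filter" where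
  "uniformity_ell2 = (INF e\<in>{0<..}. principal {(f, g). dist f g < e})"

definition open_ell2 :: "'a ell2 set \<Rightarrow> bool" where
  "open_ell2 U \<longleftrightarrow> (\<forall>f\<in>U. \<forall>\<^sub>F (f', g) in uniformity. f' = f \<longrightarrow> g \<in> U)"

instance
proof
  note smm = square_summable_product[OF Rep_ell2_summable Rep_ell2_summable]
  fix f g h :: "'a ell2" and r :: real
  show "dist f g = norm (f - g)" by (fact dist_ell2_def)
  show "sgn f = f /\<^sub>R norm f" by (fact sgn_ell2_def)
  show "uniformity = (INF e\<in>{0<..}. principal {(f, g :: 'a ell2). dist f g < e})"
    by (fact uniformity_ell2_def)
  show "open U \<longleftrightarrow> (\<forall>f\<in>U. \<forall>\<^sub>F (f', g) in uniformity. f' = f \<longrightarrow> g \<in> U)" for U :: "'a ell2 set"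
    by (fact open_ell2_def)
  have "cinner g f = cnj (cinner f g)"
    unfolding cinner_def infsum_cnj[symmetric] by (simp add: mult.commute)
  then show "inner f g = inner g f" by (simp add: inner_ell2_def)
  show "inner (f + g) h = inner f h + inner g h"
    unfolding inner_ell2_def cinner_def plus_ell2.rep_eq ring_distribs
    by (simp add: infsum_add smm)
  show "inner (r *\<^sub>R f) g = r * inner f g"
    unfolding inner_ell2_def cinner_def scaleR_ell2.rep_eq mult.assoc
    by (simp add: infsum_cmult_right')
  have inner_self: "inner f f = (\<Sum>\<^sub>\<infinity>v. (cmod (Rep_ell2 f v))\<^sup>2)"
    unfolding inner_ell2_def cinner_def
    by (subst infsum_Re[OF smm, symmetric]) (simp add: complex_norm_square[symmetric] flip: of_real_power)
  then show "0 \<le> inner f f" by (simp add: infsum_nonneg)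
  show "norm f = sqrt (inner f f)" by (simp add: norm_ell2_def inner_self)
  show "inner f f = 0 \<longleftrightarrow> f = 0"
  proof
    assume "inner f f = 0"
    then have "(cmod (Rep_ell2 f v))\<^sup>2 = 0" for v
      unfolding inner_self
      by (intro nonneg_infsum_le_0D[OF _ Rep_ell2_summable]) auto
    then have "Rep_ell2 f v = Rep_ell2 0 v" for v
      by (simp add: zero_ell2.rep_eq)
    then show "f = 0" by (simp add: Rep_ell2_inject[symmetric] ext)
  next
    assume "f = 0"
    then show "inner f f = 0" unfolding inner_self by (simp add: zero_ell2.rep_eq)
  qed
qed

end

lemma scaleR_ell2_scaleC: "r *\<^sub>R f = complex_of_real r *\<^sub>C (f :: 'a ell2)"
  by transfer simp

lift_definition ket :: "'a \<Rightarrow> 'a ell2" is "\<lambda>u v. if v = u then 1 else 0"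
proof -
  fix u :: 'a
  have "(\<lambda>v. (cmod (if v = u then 1 else 0))\<^sup>2) summable_on {u}" by simp
  then show "(\<lambda>v. (cmod (if v = u then 1 else 0))\<^sup>2) summable_on UNIV"
    by (rule summable_on_cong_neutral[THEN iffD1, rotated -1]) auto
qed


section \<open>Operators\<close>

text \<open>\<open>bounded_linear\<close> only covers real scalars.\<close>

definition bounded_clinear :: "('a ell2 \<Rightarrow> 'b ell2) \<Rightarrow> bool" where
  "bounded_clinear T \<longleftrightarrow> bounded_linear T \<and> (\<forall>c f. T (c *\<^sub>C f) = c *\<^sub>C T f)"

definition contraction :: "('a ell2 \<Rightarrow> 'a ell2) \<Rightarrow> bool" where
  "contraction T \<longleftrightarrow> bounded_clinear T \<and> onorm T \<le> 1"

definition adj :: "('a ell2 \<Rightarrow> 'a ell2) \<Rightarrow> 'a ell2 \<Rightarrow> 'a ell2" where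
  "adj T = (THE T'. \<forall>f g. cinner (T f) g = cinner f (T' g))"

definition class_C_dot_0 :: "('a ell2 \<Rightarrow> 'a ell2) \<Rightarrow> bool" where
  "class_C_dot_0 T \<longleftrightarrow> contraction T \<and> (\<forall>h. (\<lambda>n. norm ((adj T ^^ n) h)) \<longlonglongrightarrow> 0)"

definition positive_op :: "('a ell2 \<Rightarrow> 'a ell2) \<Rightarrow> bool" where
  "positive_op R \<longleftrightarrow> bounded_clinear R \<and> (\<forall>f. cinner (R f) f \<in> \<real>\<^sub>\<ge>\<^sub>0)"

definition sqrt_op :: "('a ell2 \<Rightarrow> 'a ell2) \<Rightarrow> 'a ell2 \<Rightarrow> 'a ell2" where
  "sqrt_op A = (THE R. positive_op R \<and> R \<circ> R = A)"

definition orth_compl :: "'a ell2 set \<Rightarrow> 'a ell2 set" where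
  "orth_compl M = {f. \<forall>g\<in>M. cinner f g = 0}"

definition isometry_on :: "'a ell2 set \<Rightarrow> ('a ell2 \<Rightarrow> 'b ell2) \<Rightarrow> bool" where
  "isometry_on M U \<longleftrightarrow>
     (\<forall>f\<in>M. \<forall>g\<in>M. U (f + g) = U f + U g) \<and>
     (\<forall>c. \<forall>f\<in>M. U (c *\<^sub>C f) = c *\<^sub>C U f) \<and>
     (\<forall>f\<in>M. norm (U f) = norm f)"

text \<open>
  \<open>T\<close> acts on the closed subspace \<open>M\<close> and \<open>T'\<close> on the closed subspace \<open>M'\<close>.
\<close>

definition unitarily_equivalent ::
  "'a ell2 set \<Rightarrow> ('a ell2 \<Rightarrow> 'a ell2) \<Rightarrow> 'b ell2 set \<Rightarrow> ('b ell2 \<Rightarrow> 'b ell2) \<Rightarrow> bool" where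
  "unitarily_equivalent M T M' T' \<longleftrightarrow>
     (\<exists>W. isometry_on M W \<and> W ` M = M' \<and> (\<forall>f\<in>M. W (T f) = T' (W f)))"

lift_definition unilateral_shift :: "nat ell2 \<Rightarrow> nat ell2"
  is "\<lambda>f k. case k of 0 \<Rightarrow> 0 | Suc j \<Rightarrow> f j"
proof -
  fix f :: "nat \<Rightarrow> complex"
  assume "(\<lambda>k. (cmod (f k))\<^sup>2) summable_on UNIV"
  then have "(\<lambda>k. (cmod (case k of 0 \<Rightarrow> 0 | Suc j \<Rightarrow> f j))\<^sup>2) summable_on range Suc"
    by (subst summable_on_reindex) (simp_all add: o_def)
  then show "(\<lambda>k. (cmod (case k of 0 \<Rightarrow> 0 | Suc j \<Rightarrow> f j))\<^sup>2) summable_on UNIV"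
    by (rule summable_on_cong_neutral[THEN iffD1, rotated -1]) (auto split: nat.splits)
qed

lift_definition bilateral_shift :: "int ell2 \<Rightarrow> int ell2" is "\<lambda>f n. f (n - 1)"
proof -
  fix f :: "int \<Rightarrow> complex"
  assume "(\<lambda>k. (cmod (f k))\<^sup>2) summable_on UNIV"
  moreover have "bij (\<lambda>n::int. n - 1)" by (rule bij_betwI[where g = "\<lambda>n. n + 1"]) auto
  ultimately show "(\<lambda>k. (cmod (f (k - 1)))\<^sup>2) summable_on UNIV"
    using summable_on_reindex_bij_betw[of "\<lambda>n. n - 1" UNIV UNIV "\<lambda>k. (cmod (f k))\<^sup>2"] by simp
qed

lemma unilateral_shift_ket: "unilateral_shift (ket k) = ket (Suc k)"
  by transfer (auto split: nat.splits)

lemma bilateral_shift_ket: "bilateral_shift (ket n) = ket (n + 1)"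
  by transfer auto


section \<open>Directed trees\<close>

text \<open>The vertex set is the whole type \<open>'v\<close>, hence non-empty.\<close>

definition directed_tree :: "('v \<times> 'v) set \<Rightarrow> bool" where
  "directed_tree E \<longleftrightarrow>
     irrefl E \<and> acyclic E \<and> (\<forall>u v. (u, v) \<in> (E \<union> E\<inverse>)\<^sup>*) \<and>
     (\<forall>u u' v. (u, v) \<in> E \<and> (u', v) \<in> E \<longrightarrow> u = u')"

definition is_root :: "('v \<times> 'v) set \<Rightarrow> 'v \<Rightarrow> bool" where
  "is_root E v \<longleftrightarrow> (\<nexists>u. (u, v) \<in> E)"

definition V_circ :: "('v \<times> 'v) set \<Rightarrow> 'v set" where
  "V_circ E = {v. \<not> is_root E v}"

text \<open>Arbitrary at a root.\<close>

definition par :: "('v \<times> 'v) set \<Rightarrow> 'v \<Rightarrow> 'v" where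
  "par E v = (THE u. (u, v) \<in> E)"

definition Chi_set :: "('v \<times> 'v) set \<Rightarrow> 'v set \<Rightarrow> 'v set" where
  "Chi_set E W = E `` W"

abbreviation Chi :: "('v \<times> 'v) set \<Rightarrow> 'v \<Rightarrow> 'v set" where
  "Chi E u \<equiv> Chi_set E {u}"

definition Gen :: "('v \<times> 'v) set \<Rightarrow> 'v \<Rightarrow> 'v set" where
  "Gen E u = (\<Union>n. (Chi_set E ^^ n) {(par E ^^ n) u})"


section \<open>Weighted shifts and the isometric asymptote of the adjoint\<close>

definition shift_weights :: "('v \<times> 'v) set \<Rightarrow> ('v \<Rightarrow> real) \<Rightarrow> bool" where
  "shift_weights E lam \<longleftrightarrow>
     (\<forall>v\<in>V_circ E. lam v > 0) \<and>
     (\<forall>u. (\<lambda>v. (lam v)\<^sup>2) summable_on Chi E u) \<and>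
     bdd_above (range (\<lambda>u. \<Sum>\<^sub>\<infinity>v\<in>Chi E u. (lam v)\<^sup>2))"

definition is_weighted_shift ::
  "('v \<times> 'v) set \<Rightarrow> ('v \<Rightarrow> real) \<Rightarrow> ('v ell2 \<Rightarrow> 'v ell2) \<Rightarrow> bool" where
  "is_weighted_shift E lam S \<longleftrightarrow>
     bounded_clinear S \<and> (\<forall>u. ((\<lambda>v. lam v *\<^sub>R ket v) has_sum S (ket u)) (Chi E u))"

definition A_star :: "('a ell2 \<Rightarrow> 'a ell2) \<Rightarrow> 'a ell2 \<Rightarrow> 'a ell2" where
  "A_star S f = lim (\<lambda>n. (S ^^ n) ((adj S ^^ n) f))"

definition H0_star :: "('a ell2 \<Rightarrow> 'a ell2) \<Rightarrow> 'a ell2 set" where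
  "H0_star S = {f. A_star S f = 0}"

text \<open>
  An operator on the subspace \<open>orth_compl (H0_star S)\<close> is represented by an extensional function,
  which makes the isometric asymptote of \<open>adj S\<close> literally unique.
\<close>

definition is_U_star :: "('a ell2 \<Rightarrow> 'a ell2) \<Rightarrow> ('a ell2 \<Rightarrow> 'a ell2) \<Rightarrow> bool" where
  "is_U_star S U \<longleftrightarrow>
     U \<in> orth_compl (H0_star S) \<rightarrow>\<^sub>E orth_compl (H0_star S) \<and>
     isometry_on (orth_compl (H0_star S)) U \<and>
     (\<forall>f. sqrt_op (A_star S) (adj S f) = U (sqrt_op (A_star S) f))"

definition U_star :: "('a ell2 \<Rightarrow> 'a ell2) \<Rightarrow> 'a ell2 \<Rightarrow> 'a ell2" where
  "U_star S = (THE U. is_U_star S U)"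

text \<open>
  The infinite product of the weights along the ancestors of \<open>v\<close>, as the limit of the partial
  products: \<open>prodinf\<close> would be unspecified, rather than \<open>0\<close>, for products diverging to \<open>0\<close>.
\<close>

definition par_prod :: "('v \<times> 'v) set \<Rightarrow> ('v \<Rightarrow> real) \<Rightarrow> 'v \<Rightarrow> real" where
  "par_prod E w v = lim (\<lambda>n. \<Prod>j<n. w ((par E ^^ j) v))"

definition h_vec :: "('v \<times> 'v) set \<Rightarrow> ('v \<Rightarrow> real) \<Rightarrow> 'v \<Rightarrow> 'v ell2" where
  "h_vec E lam u = (\<Sum>\<^sub>\<infinity>v\<in>Gen E u. par_prod E lam v *\<^sub>R ket v)"

definition a_coef :: "('v \<times> 'v) set \<Rightarrow> ('v \<Rightarrow> real) \<Rightarrow> 'v \<Rightarrow> real" where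
  "a_coef E lam u = (norm (h_vec E lam u))\<^sup>2"

end

theory Submission
  imports Defs
begin

text \<open>
  Whether the norm of \<open>S\<^sup>*\<^sup>n e\<^sub>v\<close> tends to zero does not change along an edge, because
  \<open>S\<^sup>* e\<^sub>v = \<lambda>\<^sub>v e\<^sub>u\<close> with \<open>\<lambda>\<^sub>v > 0\<close> and \<open>u\<close> the parent of \<open>v\<close>. By connectedness
  it fails for every vertex if \<open>S\<close> is not of class C.0; hence there is no root and the infinite products
  are positive. Then \<open>S\<^sup>n S\<^sup>*\<^sup>n e\<^sub>v\<close> converges to \<open>p\<^sub>v h\<^sub>v\<close>, where \<open>p\<^sub>v\<close>
  is the infinite product at \<open>v\<close>, so that the normalised vectors \<open>h\<^sub>u\<close>, one for each generation,
  form an orthonormal family of eigenvectors of \<open>A\<^sub>*\<close> with eigenvalues \<open>a\<^sub>u\<close> spanning the complement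
  of its kernel. In the coordinates of this family \<open>A\<^sub>*\<close> is diagonal, and \<open>S h\<^sub>u = h\<^sub>v\<close>, for \<open>u\<close> the
  parent of \<open>v\<close>, turns the defining relation of \<open>U\<^sub>*\<close> into a shift of the generations. These are
  indexed by the integers, or by the natural numbers counted upwards from the last one.
\<close>


section \<open>Square-summable functions\<close>

lemma ell2_eqI: "(\<And>v. Rep_ell2 f v = Rep_ell2 g v) \<Longrightarrow> f = g"
  by (simp add: Rep_ell2_inject[symmetric] ext)

lemma Rep_ell2_sum: "Rep_ell2 (\<Sum>i\<in>F. f i) v = (\<Sum>i\<in>F. Rep_ell2 (f i) v)"
  by (induction F rule: infinite_finite_induct) (simp_all add: zero_ell2.rep_eq plus_ell2.rep_eq)

lemma Rep_ell2_scaleR: "Rep_ell2 (r *\<^sub>R f) v = r * Rep_ell2 f v"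
  by (simp add: scaleR_ell2.rep_eq)

lemma has_sum_norm_ell2: "((\<lambda>v. (cmod (Rep_ell2 f v))\<^sup>2) has_sum (norm f)\<^sup>2) UNIV"
  by (simp add: norm_ell2_def infsum_nonneg Rep_ell2_summable)

lemma norm_ell2_ge: "cmod (Rep_ell2 f v) \<le> norm f"
proof -
  have "(\<Sum>v\<in>{v}. (cmod (Rep_ell2 f v))\<^sup>2) \<le> (norm f)\<^sup>2"
    by (rule has_sum_mono2[OF has_sum_finite has_sum_norm_ell2]) auto
  then show ?thesis by (simp add: power2_le_iff_abs_le)
qed

lemma cinner_summable: "(\<lambda>v. Rep_ell2 f v * cnj (Rep_ell2 g v)) summable_on UNIV"
  by (rule square_summable_product[OF Rep_ell2_summable Rep_ell2_summable])

lemma cinner_commute: "cinner g f = cnj (cinner f g)"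
  unfolding cinner_def infsum_cnj[symmetric] by (simp add: mult.commute)

lemma cinner_add_left: "cinner (f + g) h = cinner f h + cinner g h"
  unfolding cinner_def plus_ell2.rep_eq ring_distribs by (simp add: infsum_add cinner_summable)

lemma cinner_scaleC_left: "cinner (c *\<^sub>C f) g = c * cinner f g"
  unfolding cinner_def scaleC.rep_eq mult.assoc by (simp add: infsum_cmult_right')

lemma cinner_scaleR_left: "cinner (r *\<^sub>R f) g = r * cinner f g"
  by (simp add: scaleR_ell2_scaleC cinner_scaleC_left)

lemma cinner_zero_left [simp]: "cinner 0 g = 0"
  by (simp add: cinner_def zero_ell2.rep_eq)

lemma cinner_minus_left: "cinner (- f) g = - cinner f g"
  using cinner_scaleR_left[of "-1" f g] by simp

lemma cinner_diff_left: "cinner (f - g) h = cinner f h - cinner g h"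
  using cinner_add_left[of f "- g" h] by (simp add: cinner_minus_left)

lemma cinner_sum_left: "cinner (\<Sum>i\<in>F. f i) g = (\<Sum>i\<in>F. cinner (f i) g)"
  by (induction F rule: infinite_finite_induct) (simp_all add: cinner_add_left)

lemma cinner_add_right: "cinner h (f + g) = cinner h f + cinner h g"
  by (metis cinner_commute cinner_add_left complex_cnj_add)

lemma cinner_diff_right: "cinner h (f - g) = cinner h f - cinner h g"
  by (metis cinner_commute cinner_diff_left complex_cnj_diff)

lemma cinner_scaleC_right: "cinner f (c *\<^sub>C g) = cnj c * cinner f g"
  by (metis cinner_commute cinner_scaleC_left complex_cnj_mult)

lemma cinner_scaleR_right: "cinner f (r *\<^sub>R g) = r * cinner f g"
  by (simp add: scaleR_ell2_scaleC cinner_scaleC_right)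

lemma cinner_zero_right [simp]: "cinner g 0 = 0"
  by (simp add: cinner_def zero_ell2.rep_eq)

lemma cinner_sum_right: "cinner g (\<Sum>i\<in>F. f i) = (\<Sum>i\<in>F. cinner g (f i))"
  by (induction F rule: infinite_finite_induct) (simp_all add: cinner_add_right)

lemma cinner_self: "cinner f f = complex_of_real ((norm f)\<^sup>2)"
proof (rule complex_eqI)
  show "Re (cinner f f) = Re (complex_of_real ((norm f)\<^sup>2))"
    by (simp add: power2_norm_eq_inner inner_ell2_def)
  have "Im (cinner f f) = 0"
    using cinner_commute[of f f] by (metis Reals_cnj_iff complex_is_Real_iff)
  then show "Im (cinner f f) = Im (complex_of_real ((norm f)\<^sup>2))" by simp
qed

lemma cinner_self_eq_0: "cinner f f = 0 \<longleftrightarrow> f = 0"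
  by (simp add: cinner_self)

lemma norm_scaleC: "norm (c *\<^sub>C (f :: 'a ell2)) = cmod c * norm f"
proof -
  have "complex_of_real ((norm (c *\<^sub>C f))\<^sup>2) = complex_of_real ((cmod c * norm f)\<^sup>2)"
    unfolding cinner_self[symmetric] cinner_scaleC_left cinner_scaleC_right power_mult_distrib
    by (simp add: cinner_self complex_norm_square mult.commute del: of_real_power)

  then show ?thesis by (simp only: of_real_eq_iff power2_eq_iff_nonneg norm_ge_zero mult_nonneg_nonneg)
qed

text \<open>Multiplying \<open>f\<close> by a unimodular scalar makes the inner product equal to its
  modulus, so the real inequality for \<open>inner\<close> applies.\<close>

lemma cinner_Cauchy_Schwarz: "cmod (cinner f g) \<le> norm f * norm g"
proof (cases "cinner f g = 0")
  case False
  define c where "c = cnj (sgn (cinner f g))"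
  have c: "cmod c = 1" using False by (simp add: c_def norm_sgn)
  have "cinner (c *\<^sub>C f) g = cmod (cinner f g)"
    unfolding c_def cinner_scaleC_left sgn_eq
    using False by (simp add: field_simps complex_norm_square[symmetric] power2_eq_square)
  then have "cmod (cinner f g) = inner (c *\<^sub>C f) g" by (simp add: inner_ell2_def)
  also have "\<dots> \<le> norm (c *\<^sub>C f) * norm g" by (rule norm_cauchy_schwarz)
  finally show ?thesis by (simp add: norm_scaleC c)
qed simp

lemma cinner_ext_right: "(\<And>f. cinner f g = cinner f h) \<Longrightarrow> g = h"
  by (metis cinner_diff_right cinner_self_eq_0 right_minus_eq)

lemma Rep_ell2_ket: "Rep_ell2 (ket u) v = (if v = u then 1 else 0)"
  by (simp add: ket.rep_eq)

lemma cinner_ket: "cinner f (ket u) = Rep_ell2 f u"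
proof -
  have "cinner f (ket u) = (\<Sum>\<^sub>\<infinity>v\<in>{u}. Rep_ell2 f v)"
    unfolding cinner_def by (rule infsum_cong_neutral) (auto simp: Rep_ell2_ket)
  then show ?thesis by simp
qed

lemma cinner_ket_left: "cinner (ket u) f = cnj (Rep_ell2 f u)"
  using cinner_commute[of "ket u" f] by (simp add: cinner_ket)

lemma norm_ket [simp]: "norm (ket u) = 1"
proof -
  have "complex_of_real ((norm (ket u))\<^sup>2) = 1"
    unfolding cinner_self[symmetric] by (simp add: cinner_ket Rep_ell2_ket)
  then show ?thesis
    by (simp only: of_real_eq_1_iff power2_eq_1_iff) (smt (verit) norm_ge_zero)
qed

lemma scaleC_diff_right: "c *\<^sub>C (f - g) = c *\<^sub>C f - c *\<^sub>C g"
  by (rule ell2_eqI) (simp add: scaleC.rep_eq minus_ell2.rep_eq algebra_simps)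

lemma norm_sum_ket: "(norm (\<Sum>v\<in>F. c v *\<^sub>C ket v))\<^sup>2 = (\<Sum>v\<in>F. (cmod (c v))\<^sup>2)"
proof (cases "finite F")
  case True
  have "Rep_ell2 (\<Sum>v\<in>F. c v *\<^sub>C ket v) u = (if u \<in> F then c u else 0)" for u
    by (simp add: Rep_ell2_sum scaleC.rep_eq Rep_ell2_ket True if_distrib cong: if_cong)
  then have "complex_of_real ((norm (\<Sum>v\<in>F. c v *\<^sub>C ket v))\<^sup>2) = (\<Sum>v\<in>F. c v * cnj (c v))"
    unfolding cinner_self[symmetric] cinner_sum_right cinner_scaleC_right cinner_ket
    by (simp add: mult.commute)
  also have "\<dots> = complex_of_real (\<Sum>v\<in>F. (cmod (c v))\<^sup>2)"
    by (simp add: complex_norm_square[symmetric] flip: of_real_power)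
  finally show ?thesis by (simp only: of_real_eq_iff)
qed simp

lemma tendsto_norm_square:
  fixes f :: "'a \<Rightarrow> 'b::real_normed_vector"
  assumes "((\<lambda>x. (norm (f x - l))\<^sup>2) \<longlongrightarrow> 0) F"
  shows "(f \<longlongrightarrow> l) F"
proof -
  have "((\<lambda>x. norm (f x - l)) \<longlongrightarrow> 0) F"
    using tendsto_real_sqrt[OF assms] by simp
  then show ?thesis by (rule LIM_zero_cancel[OF tendsto_norm_zero_cancel])
qed

text \<open>By orthonormality the squared error of a finite partial sum is
  \<open>(norm f)\<^sup>2\<close> minus the partial sum of the squared moduli, which tends to
  zero.\<close>

lemma ket_expansion: "((\<lambda>v. Rep_ell2 f v *\<^sub>C ket v) has_sum f) UNIV"
proof -
  have *: "(norm ((\<Sum>v\<in>F. Rep_ell2 f v *\<^sub>C ket v) - f))\<^sup>2 = (norm f)\<^sup>2 - (\<Sum>v\<in>F. (cmod (Rep_ell2 f v))\<^sup>2)"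
    if "finite F" for F
  proof -
    let ?s = "\<Sum>v\<in>F. Rep_ell2 f v *\<^sub>C ket v"
    have "cinner ?s f = complex_of_real (\<Sum>v\<in>F. (cmod (Rep_ell2 f v))\<^sup>2)"
      by (simp add: cinner_sum_left cinner_scaleC_left cinner_ket_left complex_norm_square[symmetric]
          flip: of_real_power)
    then have "inner ?s f = (\<Sum>v\<in>F. (cmod (Rep_ell2 f v))\<^sup>2)" by (simp add: inner_ell2_def)
    then show ?thesis
      using norm_sum_ket[of "Rep_ell2 f" F]
      by (simp add: power2_norm_eq_inner inner_diff_left inner_diff_right inner_commute)
  qed
  have "((\<lambda>F. (norm f)\<^sup>2 - (\<Sum>v\<in>F. (cmod (Rep_ell2 f v))\<^sup>2)) \<longlongrightarrow> (norm f)\<^sup>2 - (norm f)\<^sup>2)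
      (finite_subsets_at_top UNIV)"
    by (intro tendsto_intros has_sum_norm_ell2[unfolded has_sum_def])
  then have "((\<lambda>F. (norm f)\<^sup>2 - (\<Sum>v\<in>F. (cmod (Rep_ell2 f v))\<^sup>2)) \<longlongrightarrow> 0) (finite_subsets_at_top UNIV)"
    by simp
  then have "((\<lambda>F. (norm ((\<Sum>v\<in>F. Rep_ell2 f v *\<^sub>C ket v) - f))\<^sup>2) \<longlongrightarrow> 0) (finite_subsets_at_top UNIV)"
    by (subst tendsto_cong)
       (auto simp: eventually_finite_subsets_at_top * intro!: exI[of _ "{}"])
  then show ?thesis
    unfolding has_sum_def by (rule tendsto_norm_square)
qed

lemma Rep_Abs_ell2:
  "(\<lambda>v. (cmod (f v))\<^sup>2) summable_on UNIV \<Longrightarrow> Rep_ell2 (Abs_ell2 f) = f"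
  by (simp add: Abs_ell2_inverse)

lemma norm_ell2_le:
  assumes "0 \<le> K" "\<And>F. finite F \<Longrightarrow> (\<Sum>v\<in>F. (cmod (Rep_ell2 f v))\<^sup>2) \<le> K\<^sup>2"
  shows "norm f \<le> K"
proof -
  have "(\<Sum>\<^sub>\<infinity>v. (cmod (Rep_ell2 f v))\<^sup>2) \<le> K\<^sup>2"
    using assms(2) by (intro infsum_le_finite_sums Rep_ell2_summable) auto
  then show ?thesis
    using assms(1) by (simp add: norm_ell2_def real_le_lsqrt infsum_nonneg)
qed

lemma square_summableI:
  assumes "\<And>F. finite F \<Longrightarrow> (\<Sum>v\<in>F. (cmod (f v))\<^sup>2) \<le> K"
  shows "(\<lambda>v. (cmod (f v))\<^sup>2) summable_on UNIV"
  using assms by (intro nonneg_bdd_above_summable_on) (auto intro!: bdd_aboveI)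


section \<open>Bounded operators and their adjoints\<close>

lemma bounded_clinearI:
  assumes "\<And>f g. T (f + g) = T f + T g" "\<And>c f. T (c *\<^sub>C f) = c *\<^sub>C T f"
    "\<And>f. norm (T f) \<le> K * norm f"
  shows "bounded_clinear T"
  unfolding bounded_clinear_def using assms
  by (auto intro!: bounded_linear_intro[where K = K] simp: scaleR_ell2_scaleC mult.commute)

lemma bounded_clinear_add: "bounded_clinear T \<Longrightarrow> T (f + g) = T f + T g"
  by (simp add: bounded_clinear_def linear_simps)

lemma bounded_clinear_scaleC: "bounded_clinear T \<Longrightarrow> T (c *\<^sub>C f) = c *\<^sub>C T f"
  by (simp add: bounded_clinear_def)

lemma bounded_clinear_scaleR: "bounded_clinear T \<Longrightarrow> T (r *\<^sub>R f) = r *\<^sub>R T f"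
  by (simp add: bounded_clinear_def linear_simps)

lemma bounded_clinear_diff: "bounded_clinear T \<Longrightarrow> T (f - g) = T f - T g"
  by (simp add: bounded_clinear_def linear_simps)

lemma bounded_clinear_zero: "bounded_clinear T \<Longrightarrow> T 0 = 0"
  by (simp add: bounded_clinear_def linear_simps)

lemma bounded_clinear_sum: "bounded_clinear T \<Longrightarrow> T (\<Sum>i\<in>F. f i) = (\<Sum>i\<in>F. T (f i))"
  by (induction F rule: infinite_finite_induct) (simp_all add: bounded_clinear_zero bounded_clinear_add)

lemma bounded_clinear_bound:
  assumes "bounded_clinear T"
  shows "\<exists>K\<ge>0. \<forall>f. norm (T f) \<le> K * norm f"
  using assms bounded_linear.nonneg_bounded[of T] by (auto simp: bounded_clinear_def mult.commute)

lemma bounded_clinear_compose: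
  "bounded_clinear T \<Longrightarrow> bounded_clinear R \<Longrightarrow> bounded_clinear (\<lambda>f. T (R f))"
  by (auto simp: bounded_clinear_def intro: bounded_linear_compose)

lemma bounded_clinear_minus:
  "bounded_clinear T \<Longrightarrow> bounded_clinear R \<Longrightarrow> bounded_clinear (\<lambda>f. T f - R f)"
  by (auto simp: bounded_clinear_def scaleC_diff_right intro: bounded_linear_sub)

lemma bounded_clinear_id: "bounded_clinear (\<lambda>f. f)"
  by (auto simp: bounded_clinear_def)

lemma bounded_clinear_funpow:
  fixes T :: "'a ell2 \<Rightarrow> 'a ell2"
  shows "bounded_clinear T \<Longrightarrow> bounded_clinear (T ^^ n)"
  by (induction n) (simp_all add: id_def comp_def bounded_clinear_id bounded_clinear_compose[of T])

lemma bounded_linear_cinner_left: "bounded_linear (\<lambda>f. cinner f g)"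
  by (rule bounded_linear_intro[where K = "norm g"])
     (auto simp: cinner_add_left cinner_scaleR_left cinner_Cauchy_Schwarz scaleR_conv_of_real)

lemma has_sum_cinner_ket:
  assumes "bounded_clinear T"
  shows "((\<lambda>u. Rep_ell2 f u * cinner (T (ket u)) g) has_sum cinner (T f) g) UNIV"
proof -
  have "bounded_linear (\<lambda>f. cinner (T f) g)"
    using assms by (intro bounded_linear_compose[OF bounded_linear_cinner_left]) (simp add: bounded_clinear_def)
  from has_sum_bounded_linear[OF this ket_expansion[of f]]
  show ?thesis by (simp add: bounded_clinear_scaleC[OF assms] cinner_scaleC_left)
qed

text \<open>A density argument: finite combinations of basis vectors approximate \<open>f\<close>,
  and the uniform bound \<open>K\<close> controls the remainder for all \<open>n\<close> at
  once.\<close>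

lemma strong_limit_ket:
  assumes L: "\<And>n. bounded_clinear (L n)" "\<And>n f. norm (L n f) \<le> K * norm f"
    and ket: "\<And>v. (\<lambda>n. L n (ket v)) \<longlonglongrightarrow> 0"
  shows "(\<lambda>n. L n f) \<longlonglongrightarrow> 0"
proof (rule LIMSEQ_I, simp)
  fix e :: real assume "e > 0"
  \<comment> \<open>Makes the remainder at most \<open>e / 2\<close>;
    \<open>\<bar>K\<bar> + 1\<close> is positive whatever the value of \<open>K\<close>.\<close>
  define d where "d = e / (2 * (\<bar>K\<bar> + 1))"
  have "d > 0" using \<open>e > 0\<close> by (simp add: d_def)
  have "\<forall>\<^sub>F F in finite_subsets_at_top UNIV. dist (\<Sum>v\<in>F. Rep_ell2 f v *\<^sub>C ket v) f < d"
    using ket_expansion[of f] \<open>d > 0\<close> unfolding has_sum_def tendsto_iff by blast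
  then obtain F where F: "finite F" "dist (\<Sum>v\<in>F. Rep_ell2 f v *\<^sub>C ket v) f < d"
    unfolding eventually_finite_subsets_at_top by blast
  let ?s = "\<Sum>v\<in>F. Rep_ell2 f v *\<^sub>C ket v"
  have "(\<lambda>n. \<Sum>v\<in>F. cmod (Rep_ell2 f v) * norm (L n (ket v))) \<longlonglongrightarrow> (\<Sum>v\<in>F. cmod (Rep_ell2 f v) * 0)"
    by (intro tendsto_intros tendsto_norm_zero ket)
  then have "\<forall>\<^sub>F n in sequentially. (\<Sum>v\<in>F. cmod (Rep_ell2 f v) * norm (L n (ket v))) < e / 2"
    using order_tendstoD(2)[where a = "e/2"] \<open>e > 0\<close> by force
  then obtain N where N: "\<And>n. n \<ge> N \<Longrightarrow> (\<Sum>v\<in>F. cmod (Rep_ell2 f v) * norm (L n (ket v))) < e / 2"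
    by (auto simp: eventually_sequentially)
  have "norm (L n f) < e" if "n \<ge> N" for n
  proof -
    have "L n f = L n (f - ?s) + (\<Sum>v\<in>F. Rep_ell2 f v *\<^sub>C L n (ket v))"
      by (simp add: bounded_clinear_diff[OF L(1)] bounded_clinear_sum[OF L(1)] bounded_clinear_scaleC[OF L(1)])
    moreover have "norm (\<Sum>v\<in>F. Rep_ell2 f v *\<^sub>C L n (ket v)) \<le> (\<Sum>v\<in>F. cmod (Rep_ell2 f v) * norm (L n (ket v)))"
      by (rule sum_norm_le) (simp add: norm_scaleC)
    ultimately have "norm (L n f) \<le> norm (L n (f - ?s)) + (\<Sum>v\<in>F. cmod (Rep_ell2 f v) * norm (L n (ket v)))"
      by (metis (no_types) norm_triangle_le add_left_mono)
    moreover have "norm (L n (f - ?s)) \<le> (\<bar>K\<bar> + 1) * d"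
    proof -
      have "norm (L n (f - ?s)) \<le> K * norm (f - ?s)" by (rule L(2))
      also have "\<dots> \<le> (\<bar>K\<bar> + 1) * d"
        using F(2) by (intro mult_mono) (auto simp: dist_norm norm_minus_commute)
      finally show ?thesis .
    qed
    moreover have "(\<bar>K\<bar> + 1) * d = e / 2" by (simp add: d_def divide_simps)
    ultimately show ?thesis using N[OF that] by linarith
  qed
  then show "\<exists>no. \<forall>n\<ge>no. norm (L n f) < e" by blast
qed

lemma bounded_clinear_ket_ext:
  assumes "bounded_clinear T" "bounded_clinear R" "\<And>v. T (ket v) = R (ket v)"
  shows "T f = R f"
proof -
  have D: "bounded_clinear (\<lambda>f. T f - R f)" by (rule bounded_clinear_minus[OF assms(1,2)])
  then obtain K where "\<And>f. norm (T f - R f) \<le> K * norm f" using bounded_clinear_bound by blast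
  from strong_limit_ket[of "\<lambda>_ f. T f - R f", OF D this]
  have "(\<lambda>n::nat. T f - R f) \<longlonglongrightarrow> 0" by (simp add: assms(3))
  then show ?thesis using LIMSEQ_unique tendsto_const by (metis right_minus_eq)
qed

section \<open>Bessel families and the analysis operator\<close>

definition analysis :: "('i \<Rightarrow> 'b ell2) \<Rightarrow> 'b ell2 \<Rightarrow> 'i ell2" where
  "analysis g f = Abs_ell2 (\<lambda>i. cinner f (g i))"

text \<open>The bound is placed on finite linear combinations because this form is immediate for
  images of the standard basis and for orthonormal families. Bessel's inequality, which makes
  \<open>analysis g\<close> well defined, follows by duality.\<close>

locale bessel_family =
  fixes g :: "'i \<Rightarrow> 'b ell2" and K :: real
  assumes K_nonneg: "0 \<le> K"
    and synthesis_bound: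
      "\<And>F c. finite F \<Longrightarrow> norm (\<Sum>i\<in>F. c i *\<^sub>C g i) \<le> K * sqrt (\<Sum>i\<in>F. (cmod (c i))\<^sup>2)"
begin

text \<open>Pairing \<open>f\<close> with \<open>?x\<close> returns the sum \<open>?q\<close>
  itself, so Cauchy-Schwarz and the synthesis bound give
  \<open>?q \<le> K * norm f * sqrt ?q\<close>; a factor \<open>sqrt ?q\<close> cancels.\<close>

lemma bessel_finite:
  assumes "finite F"
  shows "(\<Sum>i\<in>F. (cmod (cinner f (g i)))\<^sup>2) \<le> (K * norm f)\<^sup>2"
proof -
  let ?q = "\<Sum>i\<in>F. (cmod (cinner f (g i)))\<^sup>2"
  let ?x = "\<Sum>i\<in>F. cinner f (g i) *\<^sub>C g i"
  have q0: "?q \<ge> 0" by (simp add: sum_nonneg)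
  have "cinner f ?x = complex_of_real ?q"
    by (simp add: cinner_sum_right cinner_scaleC_right complex_norm_square[symmetric] mult.commute
        flip: of_real_power)
  then have "cmod (cinner f ?x) = ?q" using q0 by (simp only: norm_of_real abs_of_nonneg)
  then have "?q \<le> norm f * norm ?x" using cinner_Cauchy_Schwarz[of f ?x] by simp
  also have "\<dots> \<le> norm f * (K * sqrt ?q)"
    by (intro mult_left_mono synthesis_bound assms) simp
  finally have 1: "sqrt ?q * sqrt ?q \<le> (K * norm f) * sqrt ?q" using q0 by (simp add: mult_ac)
  have "sqrt ?q \<le> K * norm f"
  proof (cases "sqrt ?q = 0")
    case True
    then show ?thesis using K_nonneg by simp
  next
    case False
    then have "sqrt ?q > 0" using q0 by simp
    then show ?thesis using 1 by (rule mult_right_le_imp_le[rotated])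
  qed
  then have "(sqrt ?q)\<^sup>2 \<le> (K * norm f)\<^sup>2" using q0 by (intro power_mono) auto
  then show ?thesis using q0 by simp
qed

lemma Rep_analysis: "Rep_ell2 (analysis g f) i = cinner f (g i)"
  unfolding analysis_def by (subst Rep_Abs_ell2) (auto intro: square_summableI bessel_finite)

lemma norm_analysis_le: "norm (analysis g f) \<le> K * norm f"
  by (rule norm_ell2_le) (auto simp: Rep_analysis K_nonneg bessel_finite)

lemma bounded_clinear_analysis: "bounded_clinear (analysis g)"
  by (rule bounded_clinearI[where K = K])
     (auto intro!: ell2_eqI simp: Rep_analysis plus_ell2.rep_eq scaleC.rep_eq cinner_add_left
       cinner_scaleC_left norm_analysis_le)

end

section \<open>Adjoints as analysis operators\<close>

lemma bessel_family_image:
  assumes "bounded_clinear T" "0 \<le> K" "\<And>f. norm (T f) \<le> K * norm f"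
  shows "bessel_family (\<lambda>u. T (ket u)) K"
proof
  fix F :: "'a set" and c :: "'a \<Rightarrow> complex"
  let ?s = "\<Sum>i\<in>F. c i *\<^sub>C ket i"
  have "(\<Sum>i\<in>F. c i *\<^sub>C T (ket i)) = T ?s"
    by (simp add: bounded_clinear_sum[OF assms(1)] bounded_clinear_scaleC[OF assms(1)])
  moreover have "norm ?s = sqrt (\<Sum>i\<in>F. (cmod (c i))\<^sup>2)"
    by (simp flip: norm_sum_ket)
  ultimately show "norm (\<Sum>i\<in>F. c i *\<^sub>C T (ket i)) \<le> K * sqrt (\<Sum>i\<in>F. (cmod (c i))\<^sup>2)"
    using assms(3)[of ?s] by simp
qed (rule assms(2))

lemma ex_bessel_family_image: "bounded_clinear T \<Longrightarrow> \<exists>K. bessel_family (\<lambda>u. T (ket u)) K"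
  using bessel_family_image bounded_clinear_bound by blast

lemma cinner_analysis_image:
  assumes "bounded_clinear T"
  shows "cinner f (analysis (\<lambda>u. T (ket u)) g) = cinner (T f) g"
proof -
  obtain K where "bessel_family (\<lambda>u. T (ket u)) K"
    using ex_bessel_family_image[OF assms] by auto
  then have "((\<lambda>u. Rep_ell2 f u * cinner (T (ket u)) g) has_sum cinner f (analysis (\<lambda>u. T (ket u)) g)) UNIV"
    unfolding cinner_def[of f]
    using cinner_summable[of f "analysis (\<lambda>u. T (ket u)) g"]
    by (simp add: bessel_family.Rep_analysis cinner_commute[of _ g, symmetric])
  with has_sum_cinner_ket[OF assms] show ?thesis by (metis has_sum_unique)
qed

text \<open>Unlike \<^const>\<open>adj\<close>, this covers operators between different spaces.\<close>

definition hadj :: "('a ell2 \<Rightarrow> 'b ell2) \<Rightarrow> 'b ell2 \<Rightarrow> 'a ell2" where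
  "hadj T = (THE T'. \<forall>f g. cinner (T f) g = cinner f (T' g))"

lemma adj_eq_hadj: "adj = hadj"
  by (simp add: fun_eq_iff adj_def hadj_def)

text \<open>The adjoint is built from its coordinates: entry \<open>u\<close> of
  \<open>hadj T g\<close> must be \<open>cinner g (T (ket u))\<close>, and these entries are
  square-summable by Bessel's inequality. Uniqueness holds since inner products determine a
  vector.\<close>

lemma hadj_eq_analysis:
  assumes "bounded_clinear T"
  shows "hadj T = analysis (\<lambda>u. T (ket u))"
  unfolding hadj_def
proof (rule the_equality)
  show "\<forall>f g. cinner (T f) g = cinner f (analysis (\<lambda>u. T (ket u)) g)"
    by (simp add: cinner_analysis_image assms)
  fix T' assume "\<forall>f g. cinner (T f) g = cinner f (T' g)"
  then show "T' = analysis (\<lambda>u. T (ket u))"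
    using cinner_analysis_image[OF assms] by (metis cinner_ext_right ext)
qed

lemma Rep_hadj: "bounded_clinear T \<Longrightarrow> Rep_ell2 (hadj T g) u = cinner g (T (ket u))"
  using ex_bessel_family_image[of T] bessel_family.Rep_analysis by (auto simp: hadj_eq_analysis)

lemma bounded_clinear_hadj: "bounded_clinear T \<Longrightarrow> bounded_clinear (hadj T)"
  using ex_bessel_family_image[of T] bessel_family.bounded_clinear_analysis
  by (auto simp: hadj_eq_analysis)

lemma cinner_hadj: "bounded_clinear T \<Longrightarrow> cinner f (hadj T g) = cinner (T f) g"
  by (simp add: hadj_eq_analysis cinner_analysis_image)

lemma cinner_hadj_left: "bounded_clinear T \<Longrightarrow> cinner (hadj T g) f = cinner g (T f)"
  by (metis cinner_commute cinner_hadj)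

lemma norm_hadj_le:
  assumes T: "bounded_clinear T" and K: "0 \<le> K" "\<And>f. norm (T f) \<le> K * norm f"
  shows "norm (hadj T g) \<le> K * norm g"
  by (simp add: hadj_eq_analysis T bessel_family.norm_analysis_le[OF bessel_family_image[OF T K]])

text \<open>Polarisation: the quadratic form of \<open>R\<close> is real, and its values at
  \<open>f + g\<close> and at \<open>f + \<i> *\<^sub>C g\<close> give the imaginary and the real
  part of the symmetry relation.\<close>

lemma positive_op_self_adjoint:
  assumes "positive_op R"
  shows "cinner (R f) g = cinner f (R g)"
proof -
  have R: "bounded_clinear R" using assms by (simp add: positive_op_def)
  have real: "Im (cinner (R f) f) = 0" for f
    using assms by (auto simp: positive_op_def complex_nonneg_Reals_iff)
  have "Im (cinner (R (f + g)) (f + g)) = 0" "Im (cinner (R (f + \<i> *\<^sub>C g)) (f + \<i> *\<^sub>C g)) = 0"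
    by (rule real)+
  then have "Im (cinner (R f) g) + Im (cinner (R g) f) = 0" "Re (cinner (R g) f) - Re (cinner (R f) g) = 0"
    by (simp_all add: bounded_clinear_add[OF R] bounded_clinear_scaleC[OF R] cinner_add_left
        cinner_add_right cinner_scaleC_left cinner_scaleC_right real)
  then have "cinner (R g) f = cnj (cinner (R f) g)" by (simp add: complex_eq_iff)
  then show ?thesis by (metis cinner_commute)
qed

definition diag :: "('i \<Rightarrow> real) \<Rightarrow> 'i ell2 \<Rightarrow> 'i ell2" where
  "diag c x = Abs_ell2 (\<lambda>i. c i * Rep_ell2 x i)"

lemma
  assumes c: "\<And>i. c i \<in> {0..1}"
  shows Rep_diag: "Rep_ell2 (diag c x) i = c i * Rep_ell2 x i"
    and bounded_clinear_diag: "bounded_clinear (diag c)"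
proof -
  have le: "(cmod (c i * Rep_ell2 x i))\<^sup>2 \<le> (cmod (Rep_ell2 x i))\<^sup>2" for x i
    using c[of i] by (intro power_mono) (auto simp: norm_mult mult_left_le_one_le)
  have "(\<lambda>i. (cmod (c i * Rep_ell2 x i))\<^sup>2) summable_on UNIV" for x
    by (rule summable_on_comparison_test[OF Rep_ell2_summable[of x]]) (use le in auto)
  then have R: "Rep_ell2 (diag c x) i = c i * Rep_ell2 x i" for x i
    by (simp add: diag_def Rep_Abs_ell2)
  then show "Rep_ell2 (diag c x) i = c i * Rep_ell2 x i" .
  have "norm (diag c x) \<le> 1 * norm x" for x
    using le by (auto simp: norm_ell2_def R intro!: infsum_mono Rep_ell2_summable
        Rep_ell2_summable[of "diag c x", unfolded R])
  then show "bounded_clinear (diag c)"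
    by (intro bounded_clinearI[where K = 1] ell2_eqI)
       (auto simp: R plus_ell2.rep_eq scaleC.rep_eq algebra_simps)
qed

lemma diag_ket: "(\<And>i. c i \<in> {0..1}) \<Longrightarrow> diag c (ket i) = c i *\<^sub>R ket i"
  by (rule ell2_eqI) (simp add: Rep_diag Rep_ell2_ket Rep_ell2_scaleR)


section \<open>Operators diagonal in an orthonormal family\<close>

locale orthonormal_family =
  fixes e :: "'i \<Rightarrow> 'b ell2"
  assumes orthonormal: "cinner (e i) (e j) = (if i = j then 1 else 0)"
begin

sublocale bessel_family e 1
proof
  fix F :: "'i set" and c :: "'i \<Rightarrow> complex"
  assume F: "finite F"
  have "cinner (e i) (\<Sum>j\<in>F. c j *\<^sub>C e j) = (if i \<in> F then cnj (c i) else 0)" for i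
    by (simp add: cinner_sum_right cinner_scaleC_right orthonormal F if_distrib cong: if_cong)
  then have "complex_of_real ((norm (\<Sum>i\<in>F. c i *\<^sub>C e i))\<^sup>2) = (\<Sum>i\<in>F. c i * cnj (c i))"
    unfolding cinner_self[symmetric] cinner_sum_left cinner_scaleC_left by simp
  also have "\<dots> = complex_of_real (\<Sum>i\<in>F. (cmod (c i))\<^sup>2)"
    by (simp add: complex_norm_square[symmetric] flip: of_real_power)
  finally have "(norm (\<Sum>i\<in>F. c i *\<^sub>C e i))\<^sup>2 = (\<Sum>i\<in>F. (cmod (c i))\<^sup>2)"
    by (simp only: of_real_eq_iff)
  then show "norm (\<Sum>i\<in>F. c i *\<^sub>C e i) \<le> 1 * sqrt (\<Sum>i\<in>F. (cmod (c i))\<^sup>2)"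
    by (simp add: real_le_rsqrt)
qed simp

text \<open>As the adjoint of the analysis operator this is the sum of all \<open>x i\<close> times
  \<open>e i\<close>, obtained with no convergence argument. It is an isometry onto the closed span
  of the family, with \<open>analysis e\<close> as left inverse.\<close>

definition synthesis :: "'i ell2 \<Rightarrow> 'b ell2" where
  "synthesis = hadj (analysis e)"

lemma bounded_clinear_synthesis: "bounded_clinear synthesis"
  by (simp add: synthesis_def bounded_clinear_hadj bounded_clinear_analysis)

lemma cinner_synthesis: "cinner f (synthesis x) = cinner (analysis e f) x"
  by (simp add: synthesis_def cinner_hadj bounded_clinear_analysis)

lemma cinner_synthesis_left: "cinner (synthesis x) f = cinner x (analysis e f)"
  by (metis cinner_commute cinner_synthesis)

lemma analysis_basis: "analysis e (e i) = ket i"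
  by (rule ell2_eqI) (simp add: Rep_analysis orthonormal Rep_ell2_ket)

lemma synthesis_ket: "synthesis (ket i) = e i"
  by (rule cinner_ext_right) (simp add: cinner_synthesis cinner_ket Rep_analysis)

lemma analysis_synthesis [simp]: "analysis e (synthesis x) = x"
  by (rule ell2_eqI)
    (simp add: Rep_analysis cinner_synthesis_left analysis_basis cinner_ket)

lemma norm_synthesis [simp]: "norm (synthesis x) = norm x"
proof -
  have "complex_of_real ((norm (synthesis x))\<^sup>2) = complex_of_real ((norm x)\<^sup>2)"
    by (simp only: cinner_self[symmetric] cinner_synthesis analysis_synthesis)
  then show ?thesis by (simp only: of_real_eq_iff power2_eq_iff_nonneg norm_ge_zero)
qed

lemma synthesis_eq_0: "synthesis x = 0 \<longleftrightarrow> x = 0"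
  by (metis norm_synthesis norm_eq_zero)

text \<open>For \<open>c\<close> with values in \<open>{0..1}\<close> this has eigenvalue
  \<open>c i\<close> at \<open>e i\<close> and vanishes on the orthogonal complement of the
  family.\<close>

definition diag_op :: "('i \<Rightarrow> real) \<Rightarrow> 'b ell2 \<Rightarrow> 'b ell2" where
  "diag_op c f = synthesis (diag c (analysis e f))"

lemma bounded_clinear_diag_op: "(\<And>i. c i \<in> {0..1}) \<Longrightarrow> bounded_clinear (diag_op c)"
  unfolding diag_op_def[abs_def]
  by (rule bounded_clinear_compose[OF bounded_clinear_synthesis
        bounded_clinear_compose[OF bounded_clinear_diag bounded_clinear_analysis]])

lemma diag_op_basis: "(\<And>i. c i \<in> {0..1}) \<Longrightarrow> diag_op c (e i) = c i *\<^sub>R e i"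
  by (simp add: diag_op_def analysis_basis diag_ket bounded_clinear_scaleR bounded_clinear_synthesis
      synthesis_ket)

lemma analysis_diag_op: "analysis e (diag_op c f) = diag c (analysis e f)"
  by (simp add: diag_op_def)

lemma positive_diag_op:
  assumes c: "\<And>i. c i \<in> {0..1}"
  shows "positive_op (diag_op c)"
  unfolding positive_op_def
proof (intro conjI allI bounded_clinear_diag_op c)
  fix f
  let ?x = "analysis e f"
  have c': "sqrt (c i) \<in> {0..1}" for i using c[of i] by simp
  have "cinner (diag_op c f) f = cinner (diag (\<lambda>i. sqrt (c i)) ?x) (diag (\<lambda>i. sqrt (c i)) ?x)"
    unfolding diag_op_def cinner_synthesis_left
    unfolding cinner_def Rep_diag[OF c] Rep_diag[OF c']
    using c by (intro infsum_cong) (simp flip: of_real_mult)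
  then show "cinner (diag_op c f) f \<in> \<real>\<^sub>\<ge>\<^sub>0"
    by (simp add: cinner_self)
qed

text \<open>
  A positive square root \<open>R\<close> acts on each eigenvector as on the corresponding eigenvalue because
  \<open>R + sqrt (a i)\<close> is injective, and it annihilates the kernel.
\<close>

lemma sqrt_op_diag_op:
  assumes a: "\<And>i. a i \<in> {0<..1}"
  shows "sqrt_op (diag_op a) = diag_op (\<lambda>i. sqrt (a i))"
proof -
  let ?s = "\<lambda>i. sqrt (a i)"
  have a': "a i \<in> {0..1}" "?s i \<in> {0..1}" "?s i > 0" for i
    using a[of i] by auto
  have sq: "diag_op ?s \<circ> diag_op ?s = diag_op a"
  proof
    fix f
    have "diag ?s (diag ?s x) = diag a x" for x
      using a' by (intro ell2_eqI) (simp add: Rep_diag less_imp_le flip: mult.assoc of_real_mult)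
    then show "(diag_op ?s \<circ> diag_op ?s) f = diag_op a f"
      by (simp add: diag_op_def)
  qed
  show ?thesis
    unfolding sqrt_op_def
  proof (rule the_equality)
    show "positive_op (diag_op ?s) \<and> diag_op ?s \<circ> diag_op ?s = diag_op a"
      using sq positive_diag_op[OF a'(2)] by simp
    fix R assume R: "positive_op R \<and> R \<circ> R = diag_op a"
    then have lin: "bounded_clinear R" by (simp add: positive_op_def)
    have sa: "cinner (R f) g = cinner f (R g)" for f g
      using R positive_op_self_adjoint by blast
    have RR: "R (R f) = diag_op a f" for f
      using R by (simp add: fun_eq_iff)
    have R_basis: "R (e i) = ?s i *\<^sub>R e i" for i
    proof -
      define y where "y = R (e i) - ?s i *\<^sub>R e i"
      have "R y = a i *\<^sub>R e i - ?s i *\<^sub>R R (e i)"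
        by (simp add: y_def bounded_clinear_diff[OF lin] bounded_clinear_scaleR[OF lin] RR
            diag_op_basis[OF a'(1)])
      also have "\<dots> = - ?s i *\<^sub>R y"
        using a'(1)[of i] by (simp add: y_def scaleR_diff_right)
      finally have "cinner (R y) y = complex_of_real (- ?s i * (norm y)\<^sup>2)"
        by (simp add: cinner_scaleR_left cinner_self cinner_minus_left)
      moreover have "cinner (R y) y \<in> \<real>\<^sub>\<ge>\<^sub>0" using R by (simp add: positive_op_def)
      ultimately have "0 \<le> - ?s i * (norm y)\<^sup>2"
        by (metis nonneg_Reals_of_real_iff)
      then have "norm y = 0" using a'(3)[of i]
        by (metis mult_minus_left neg_0_le_iff_le mult_le_0_iff not_le power2_less_eq_zero_iff)
      then show ?thesis by (simp add: y_def)
    qed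
    have R_ker: "R x = 0" if "analysis e x = 0" for x
    proof -
      have "R (R x) = 0"
        by (simp add: RR diag_op_def that bounded_clinear_zero bounded_clinear_synthesis
            bounded_clinear_diag[OF a'(1)])
      then have "cinner (R x) (R x) = 0" by (metis sa cinner_zero_right)
      then show ?thesis by (simp add: cinner_self_eq_0)
    qed
    show "R = diag_op ?s"
    proof
      fix f
      \<comment> \<open>The family need not span the space, so equal coordinates do not suffice.
        They put \<open>z\<close> into the kernel of \<open>analysis e\<close>, where
        \<open>R\<close> vanishes, and self-adjointness then turns \<open>cinner z z\<close> into
        zero.\<close>
      define z where "z = R f - diag_op ?s f"
      have "analysis e (R f) = diag ?s (analysis e f)"
        by (rule ell2_eqI) (simp add: Rep_analysis sa R_basis cinner_scaleR_right Rep_diag[OF a'(2)])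
      then have z: "analysis e z = 0"
        by (simp add: z_def bounded_clinear_diff bounded_clinear_analysis analysis_diag_op)
      have "cinner z z = cinner (R f - diag_op ?s f) z" by (simp only: z_def)
      also have "\<dots> = cinner f (R z) - cinner (diag ?s (analysis e f)) (analysis e z)"
        by (simp add: cinner_diff_left diag_op_def cinner_synthesis_left sa)
      also have "\<dots> = 0" using z by (simp add: R_ker)
      finally show "R f = diag_op ?s f" by (simp add: cinner_self_eq_0 z_def)
    qed
  qed
qed

text \<open>Since every \<open>c i\<close> is nonzero, the kernel is that of
  \<open>analysis e\<close>. The residual \<open>f - synthesis (analysis e f)\<close> lies in it;
  both terms of the residual are orthogonal to the kernel, so it is zero.\<close>

lemma orth_compl_kernel:
  assumes "\<And>i. c i \<in> {0<..1}"
  shows "orth_compl {f. diag_op c f = 0} = range synthesis"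
proof -
  have c: "c i \<in> {0..1}" "c i \<noteq> 0" for i using assms[of i] by auto
  have "diag c x = 0 \<longleftrightarrow> x = 0" for x
    using c by (auto simp: Rep_ell2_inject[symmetric] fun_eq_iff Rep_diag zero_ell2.rep_eq)
  then have ker: "diag_op c f = 0 \<longleftrightarrow> analysis e f = 0" for f
    by (simp add: diag_op_def synthesis_eq_0)
  show ?thesis
  proof (intro equalityI subsetI)
    fix f assume "f \<in> orth_compl {f. diag_op c f = 0}"
    then have orth: "cinner f z = 0" if "analysis e z = 0" for z
      using that by (simp add: orth_compl_def ker)
    define z where "z = f - synthesis (analysis e f)"
    have z: "analysis e z = 0"
      by (simp add: z_def bounded_clinear_diff bounded_clinear_analysis)
    have "cinner z z = cinner (f - synthesis (analysis e f)) z" by (simp only: z_def)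
    also have "\<dots> = cinner f z - cinner (analysis e f) (analysis e z)"
      by (simp add: cinner_diff_left cinner_synthesis_left)
    finally have "z = 0" using z orth by (simp add: cinner_self_eq_0)
    then show "f \<in> range synthesis" by (auto simp: z_def)
  qed (auto simp: orth_compl_def ker cinner_synthesis_left)
qed

end

section \<open>The isometric asymptote in diagonal coordinates\<close>

text \<open>The defining relation, divided by the eigenvalue, fixes the value of \<open>U\<close> at
  an eigenvector of the square root; uniqueness of \<open>U\<close> rests on this.\<close>

lemma is_U_star_eigenvector:
  assumes "is_U_star S U" "f \<in> orth_compl (H0_star S)" "s \<noteq> 0" "sqrt_op (A_star S) f = s *\<^sub>R f"
  shows "U f = (1 / s) *\<^sub>R sqrt_op (A_star S) (adj S f)"
proof -
  have "s *\<^sub>R U f = U (s *\<^sub>R f)"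
    using assms(1,2) by (simp add: is_U_star_def isometry_on_def scaleR_ell2_scaleC)
  also have "\<dots> = sqrt_op (A_star S) (adj S f)"
    using assms(1,4) by (metis is_U_star_def)
  finally have "(1 / s) *\<^sub>R (s *\<^sub>R U f) = (1 / s) *\<^sub>R sqrt_op (A_star S) (adj S f)" by simp
  then show ?thesis using assms(3) by simp
qed

text \<open>\<open>T\<close> is the candidate for the asymptote in coordinates, and
  \<open>intertwine\<close> is its defining relation:
  \<open>diag (\<lambda>i. sqrt (a i)) (analysis e f)\<close> is the coordinate vector of the square
  root of \<open>A_star S\<close> at \<open>f\<close>.\<close>

locale diagonal_asymptote = orthonormal_family e
  for e :: "'i \<Rightarrow> 'b ell2" +
  fixes S :: "'b ell2 \<Rightarrow> 'b ell2" and a :: "'i \<Rightarrow> real" and T :: "'i ell2 \<Rightarrow> 'i ell2"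
  assumes a: "a i \<in> {0<..1}"
    and A_star: "A_star S = diag_op a"
    and T: "bounded_clinear T" "norm (T x) = norm x"
    and intertwine:
      "diag (\<lambda>i. sqrt (a i)) (analysis e (adj S f)) = T (diag (\<lambda>i. sqrt (a i)) (analysis e f))"
begin

lemma sqrt_A_star: "sqrt_op (A_star S) = diag_op (\<lambda>i. sqrt (a i))"
  unfolding A_star by (rule sqrt_op_diag_op[OF a])

lemma orth_compl_H0_star: "orth_compl (H0_star S) = range synthesis"
  unfolding H0_star_def A_star by (rule orth_compl_kernel[OF a])

lemma is_U_star_conjugate:
  "is_U_star S (restrict (\<lambda>f. synthesis (T (analysis e f))) (range synthesis))"
proof -
  let ?U = "restrict (\<lambda>f. synthesis (T (analysis e f))) (range synthesis)"
  have U: "?U (synthesis x) = synthesis (T x)" for x by simp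
  have "?U (synthesis x + synthesis y) = ?U (synthesis x) + ?U (synthesis y)" for x y
    unfolding U bounded_clinear_add[OF bounded_clinear_synthesis, symmetric] bounded_clinear_add[OF T(1), symmetric] ..
  moreover have "?U (c *\<^sub>C synthesis x) = c *\<^sub>C ?U (synthesis x)" for c x
    unfolding U bounded_clinear_scaleC[OF bounded_clinear_synthesis, symmetric] bounded_clinear_scaleC[OF T(1), symmetric] ..
  moreover have "norm (?U (synthesis x)) = norm (synthesis x)" for x
    by (simp add: T)
  ultimately have "isometry_on (range synthesis) ?U"
    unfolding isometry_on_def by blast
  then show ?thesis
    unfolding is_U_star_def orth_compl_H0_star sqrt_A_star
    by (auto simp: diag_op_def intertwine)
qed

text \<open>Any two candidates agree at the eigenvectors \<open>e i\<close>, then by linearity and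
  boundedness on \<open>range synthesis\<close>, and by extensionality off it.\<close>

lemma U_star_eq:
  "U_star S = restrict (\<lambda>f. synthesis (T (analysis e f))) (range synthesis)"
  unfolding U_star_def
proof (rule the_equality, rule is_U_star_conjugate)
  fix U assume U: "is_U_star S U"
  let ?U' = "restrict (\<lambda>f. synthesis (T (analysis e f))) (range synthesis)"
  have basis: "U (e i) = ?U' (e i)" for i
  proof -
    have "e i \<in> orth_compl (H0_star S)"
      using orth_compl_H0_star synthesis_ket[of i] by (metis rangeI)
    moreover have "sqrt (a i) \<noteq> 0" using a[of i] by auto
    moreover have "sqrt_op (A_star S) (e i) = sqrt (a i) *\<^sub>R e i"
      using a unfolding sqrt_A_star by (intro diag_op_basis) (auto simp: less_imp_le)
    ultimately show ?thesis
      using is_U_star_eigenvector[OF U] is_U_star_eigenvector[OF is_U_star_conjugate] by metis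
  qed
  \<comment> \<open>Composition with \<open>synthesis\<close> turns an operator on the subspace into
    one on the whole coordinate space, where agreement on basis vectors is enough.\<close>
  have lin: "bounded_clinear (\<lambda>x. V (synthesis x))" if "is_U_star S V" for V
    by (rule bounded_clinearI[where K = 1])
      (use that in \<open>auto simp: is_U_star_def isometry_on_def orth_compl_H0_star
        bounded_clinear_add[OF bounded_clinear_synthesis] bounded_clinear_scaleC[OF bounded_clinear_synthesis]\<close>)
  have "U (synthesis x) = ?U' (synthesis x)" for x
    by (rule bounded_clinear_ket_ext[OF lin[OF U] lin[OF is_U_star_conjugate]])
       (simp only: synthesis_ket basis)
  moreover have "U \<in> extensional (range synthesis)"
    using U by (auto simp: is_U_star_def orth_compl_H0_star PiE_def)
  ultimately show "U = ?U'"
    by (intro extensionalityI[of _ "range synthesis"]) auto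
qed

lemma U_star_synthesis: "U_star S (synthesis x) = synthesis (T x)"
  by (simp add: U_star_eq)

lemma unitarily_equivalent_U_star:
  "unitarily_equivalent (orth_compl (H0_star S)) (U_star S) UNIV T"
proof -
  have "isometry_on (range synthesis) (analysis e)"
    by (auto simp: isometry_on_def bounded_clinear_add bounded_clinear_scaleC bounded_clinear_analysis)
  moreover have "analysis e ` range synthesis = UNIV"
    by (auto simp: image_image)
  ultimately show ?thesis
    unfolding unitarily_equivalent_def orth_compl_H0_star
    by (intro exI[of _ "analysis e"]) (auto simp: U_star_synthesis)
qed

end


section \<open>Contractive weighted shifts that are not of class C.0\<close>

locale contractive_shift =
  fixes E :: "('v \<times> 'v) set" and lam :: "'v \<Rightarrow> real" and S :: "'v ell2 \<Rightarrow> 'v ell2"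
  assumes tree: "directed_tree E"
    and weights: "shift_weights E lam"
    and shift: "is_weighted_shift E lam S"
    and contr: "contraction S"
begin

lemma bounded_clinear_S: "bounded_clinear S"
  using contr by (simp add: contraction_def)

lemma norm_S_le: "norm (S f) \<le> norm f"
proof -
  have "norm (S f) \<le> onorm S * norm f"
    using bounded_clinear_S by (intro onorm) (simp add: bounded_clinear_def)
  also have "\<dots> \<le> 1 * norm f"
    using contr by (intro mult_right_mono) (simp_all add: contraction_def)
  finally show ?thesis by simp
qed

lemma norm_S_pow_le: "norm ((S ^^ n) f) \<le> norm f"
  by (induction n) (auto intro: order_trans[OF norm_S_le])

lemma bounded_clinear_adj: "bounded_clinear (adj S)"
  by (simp add: adj_eq_hadj bounded_clinear_hadj bounded_clinear_S)

lemma norm_adj_le: "norm (adj S f) \<le> norm f"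
  using norm_hadj_le[OF bounded_clinear_S, of 1 f] by (simp add: adj_eq_hadj norm_S_le)

lemma norm_adj_pow_le: "norm ((adj S ^^ n) f) \<le> norm f"
  by (induction n) (auto intro: order_trans[OF norm_adj_le])

lemma Rep_S_ket: "Rep_ell2 (S (ket u)) v = (if (u, v) \<in> E then lam v else 0)"
proof -
  have "((\<lambda>w. lam w *\<^sub>R ket w) has_sum S (ket u)) (Chi E u)"
    using shift by (simp add: is_weighted_shift_def)
  from has_sum_bounded_linear[OF bounded_linear_cinner_left[of "ket v"] this]
  have "((\<lambda>w. if w = v then complex_of_real (lam v) else 0) has_sum Rep_ell2 (S (ket u)) v) (Chi E u)"
    by (simp add: cinner_ket Rep_ell2_scaleR Rep_ell2_ket if_distrib cong: if_cong) (smt (verit, best) has_sum_cong)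
  moreover have "((\<lambda>w. if w = v then complex_of_real (lam v) else 0) has_sum
      (if (u, v) \<in> E then lam v else 0)) (Chi E u)"
  proof -
    have "((\<lambda>w. complex_of_real (lam v)) has_sum (if (u, v) \<in> E then lam v else 0)) (if (u, v) \<in> E then {v} else {})"
      using has_sum_finite[of "{v}" "\<lambda>w. complex_of_real (lam v)"] by simp
    then show ?thesis
      by (rule has_sum_cong_neutral[THEN iffD1, rotated -1]) (auto simp: Chi_set_def split: if_splits)
  qed
  ultimately show ?thesis by (rule has_sum_unique)
qed

lemma parent_unique: "(u, v) \<in> E \<Longrightarrow> (u', v) \<in> E \<Longrightarrow> u = u'"
  using tree unfolding directed_tree_def by blast

lemma par_eq: "(u, v) \<in> E \<Longrightarrow> par E v = u"
  unfolding par_def using parent_unique by blast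

lemma adj_S_ket: "(u, v) \<in> E \<Longrightarrow> adj S (ket v) = lam v *\<^sub>R ket u"
  by (rule ell2_eqI)
     (auto simp: adj_eq_hadj Rep_hadj bounded_clinear_S cinner_ket_left Rep_S_ket Rep_ell2_scaleR
       Rep_ell2_ket dest: parent_unique)

lemma adj_S_root: "is_root E v \<Longrightarrow> adj S (ket v) = 0"
  by (rule ell2_eqI)
     (auto simp: adj_eq_hadj Rep_hadj bounded_clinear_S cinner_ket_left Rep_S_ket is_root_def
       zero_ell2.rep_eq)

text \<open>The upper bound holds because \<open>lam v\<close> is an entry of
  \<open>S (ket u)\<close>, a vector of norm at most 1.\<close>

lemma weight_bounds: "(u, v) \<in> E \<Longrightarrow> 0 < lam v \<and> lam v \<le> 1"
proof -
  assume uv: "(u, v) \<in> E"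
  then have pos: "0 < lam v"
    using weights unfolding shift_weights_def V_circ_def is_root_def by blast
  have "cmod (Rep_ell2 (S (ket u)) v) \<le> 1"
    using norm_ell2_ge[of "S (ket u)" v] norm_S_le[of "ket u"] by simp
  then show ?thesis using pos uv by (simp add: Rep_S_ket)
qed

definition decays :: "'v \<Rightarrow> bool" where
  "decays v \<longleftrightarrow> (\<lambda>n. norm ((adj S ^^ n) (ket v))) \<longlonglongrightarrow> 0"

lemma decays_edge:
  assumes uv: "(u, v) \<in> E"
  shows "decays v \<longleftrightarrow> decays u"
proof -
  have "(adj S ^^ Suc n) (ket v) = lam v *\<^sub>R (adj S ^^ n) (ket u)" for n
    by (simp only: funpow_Suc_right comp_apply adj_S_ket[OF uv]
        bounded_clinear_scaleR[OF bounded_clinear_funpow[OF bounded_clinear_adj]])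
  then have "decays v \<longleftrightarrow> (\<lambda>n. lam v * norm ((adj S ^^ n) (ket u))) \<longlonglongrightarrow> lam v * 0"
    using weight_bounds[OF uv] unfolding decays_def by (subst filterlim_sequentially_Suc[symmetric]) simp
  also have "\<dots> \<longleftrightarrow> decays u"
    unfolding decays_def using weight_bounds[OF uv] by (intro tendsto_mult_left_iff) simp
  finally show ?thesis .
qed

lemma decays_iff: "decays u \<longleftrightarrow> decays v"
proof -
  have "(u, v) \<in> (E \<union> E\<inverse>)\<^sup>*" using tree by (simp add: directed_tree_def)
  then show ?thesis
    by (induction rule: rtrancl_induct) (use decays_edge in auto)
qed

text \<open>By \<open>decays_iff\<close> one vertex decides for all, and since the powers of
  \<open>adj S\<close> are uniformly bounded, decay on basis vectors gives decay everywhere.\<close>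

lemma class_C_dot_0_iff: "class_C_dot_0 S \<longleftrightarrow> decays v"
proof
  assume "class_C_dot_0 S"
  then show "decays v" by (simp add: class_C_dot_0_def decays_def)
next
  assume "decays v"
  then have ket: "(\<lambda>n. (adj S ^^ n) (ket w)) \<longlonglongrightarrow> 0" for w
    using decays_iff[of w v] by (simp add: decays_def tendsto_norm_zero_iff)
  have "(\<lambda>n. (adj S ^^ n) f) \<longlonglongrightarrow> 0" for f
  proof (rule strong_limit_ket)
    show "norm ((adj S ^^ n) f) \<le> 1 * norm f" for n f by (simp add: norm_adj_pow_le)
  qed (simp_all add: bounded_clinear_funpow bounded_clinear_adj ket)
  then show "class_C_dot_0 S"
    using contr by (simp add: class_C_dot_0_def tendsto_norm_zero)
qed

end

section \<open>Ancestors and infinite products of weights in the non-decaying case\<close>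

locale nondecaying_shift = contractive_shift E lam S
  for E :: "('v \<times> 'v) set" and lam S +
  assumes not_C_dot_0: "\<not> class_C_dot_0 S"
begin

text \<open>At a root the adjoint annihilates the basis vector, so its orbit would decay
  trivially.\<close>

lemma no_root: "\<not> is_root E r"
proof
  assume r: "is_root E r"
  have "(adj S ^^ Suc n) (ket r) = 0" for n
    by (simp only: funpow_Suc_right comp_apply adj_S_root[OF r]
        bounded_clinear_zero[OF bounded_clinear_funpow[OF bounded_clinear_adj]])
  then have "decays r"
    unfolding decays_def by (subst filterlim_sequentially_Suc[symmetric]) simp
  then show False using not_C_dot_0 class_C_dot_0_iff by blast
qed

lemma par_edge: "(par E v, v) \<in> E"
  using no_root[of v] par_eq unfolding is_root_def by blast

lemma edge_iff: "(u, v) \<in> E \<longleftrightarrow> u = par E v"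
  using par_edge par_eq by blast

lemma lam_pos: "0 < lam v" and lam_le_1: "lam v \<le> 1"
  using weight_bounds[OF par_edge] by blast+

abbreviation anc :: "nat \<Rightarrow> 'v \<Rightarrow> 'v" where
  "anc n v \<equiv> (par E ^^ n) v"

lemma anc_par: "anc n (par E v) = anc (Suc n) v"
  by (simp only: funpow_Suc_right comp_apply)

lemma anc_anc: "anc m (anc n v) = anc (m + n) v"
  by (simp add: funpow_add)

text \<open>By \<open>adj_pow_ket\<close> this is the norm of
  \<open>(adj S ^^ n) (ket v)\<close>.\<close>

definition pprod :: "nat \<Rightarrow> 'v \<Rightarrow> real" where
  "pprod n v = (\<Prod>j<n. lam (anc j v))"

lemma pprod_0 [simp]: "pprod 0 v = 1"
  by (simp add: pprod_def)

lemma pprod_Suc: "pprod (Suc n) v = pprod n v * lam (anc n v)"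
  by (simp add: pprod_def)

lemma pprod_par: "pprod (Suc n) v = lam v * pprod n (par E v)"
  by (simp only: pprod_def prod.lessThan_Suc_shift anc_par) simp

lemma pprod_add: "pprod (m + n) v = pprod n v * pprod m (anc n v)"
  by (induction m) (simp_all add: pprod_Suc anc_anc mult_ac)

lemma pprod_pos: "0 < pprod n v"
  by (simp add: pprod_def prod_pos lam_pos)

lemma pprod_decseq: "decseq (\<lambda>n. pprod n v)"
  using lam_pos lam_le_1 pprod_pos
  by (intro decseq_SucI) (simp add: pprod_Suc mult_left_le less_imp_le)

lemma S_apply: "Rep_ell2 (S f) v = lam v * Rep_ell2 f (par E v)"
  using cinner_hadj[OF bounded_clinear_S, of f "ket v"]
  by (simp add: adj_S_ket[OF par_edge] cinner_scaleR_right cinner_ket flip: adj_eq_hadj)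

lemma S_pow_apply: "Rep_ell2 ((S ^^ n) f) v = pprod n v * Rep_ell2 f (anc n v)"
  by (induction n arbitrary: v) (simp_all only: pprod_par anc_par[symmetric], simp_all add: S_apply)

lemma adj_pow_ket: "(adj S ^^ n) (ket v) = pprod n v *\<^sub>R ket (anc n v)"
  by (induction n)
     (simp_all add: pprod_Suc bounded_clinear_scaleR[OF bounded_clinear_adj] adj_S_ket[OF par_edge])

abbreviation p :: "'v \<Rightarrow> real" where
  "p \<equiv> par_prod E lam"

text \<open>Weights in (0,1] make the partial products decreasing and positive, so the
  \<open>lim\<close> in \<open>par_prod\<close> is a genuine limit.\<close>

lemma pprod_tendsto: "(\<lambda>n. pprod n v) \<longlonglongrightarrow> p v"
proof -
  have "convergent (\<lambda>n. pprod n v)"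
    using decseq_convergent[OF pprod_decseq[of v], of 0] pprod_pos
    by (metis convergentI less_imp_le)
  then show ?thesis
    unfolding par_prod_def pprod_def by (simp add: convergent_LIMSEQ_iff)
qed

lemma p_le_pprod: "p v \<le> pprod n v"
  by (rule decseq_ge[OF pprod_decseq pprod_tendsto])

text \<open>A vanishing product would mean that \<open>norm ((adj S ^^ n) (ket v))\<close> decays,
  which is excluded.\<close>

lemma p_pos: "0 < p v"
proof -
  have "0 \<le> p v"
    by (rule LIMSEQ_le_const[OF pprod_tendsto]) (auto intro: less_imp_le pprod_pos)
  moreover have "p v \<noteq> 0"
  proof
    assume "p v = 0"
    then have "decays v"
      using pprod_tendsto[of v] by (simp add: decays_def adj_pow_ket pprod_pos less_imp_le)
    then show False using not_C_dot_0 class_C_dot_0_iff by blast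
  qed
  ultimately show ?thesis by simp
qed

lemma p_split: "p v = pprod n v * p (anc n v)"
proof -
  have "(\<lambda>m. pprod (m + n) v) \<longlonglongrightarrow> pprod n v * p (anc n v)"
    unfolding pprod_add by (intro tendsto_intros pprod_tendsto)
  moreover have "(\<lambda>m. pprod (m + n) v) \<longlonglongrightarrow> p v"
    using pprod_tendsto by (rule LIMSEQ_ignore_initial_segment)
  ultimately show ?thesis by (rule LIMSEQ_unique[symmetric, OF _ ])
qed

text \<open>This is the tail of a product with positive limit: \<open>p_split\<close> makes it
  \<open>p v / pprod n v\<close>.\<close>

lemma p_anc_tendsto: "(\<lambda>n. p (anc n v)) \<longlonglongrightarrow> 1"
proof -
  have "(\<lambda>n. p v / pprod n v) \<longlonglongrightarrow> p v / p v"
    using p_pos[of v] by (intro tendsto_intros pprod_tendsto) simp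
  moreover have "p v / pprod n v = p (anc n v)" for n
    using p_split[of v n] pprod_pos[of n v] by simp
  ultimately show ?thesis using p_pos[of v] by simp
qed

lemma par_prod_square: "par_prod E (\<lambda>w. (lam w)\<^sup>2) v = (p v)\<^sup>2"
  unfolding par_prod_def[of E "\<lambda>w. (lam w)\<^sup>2"] prod_power_distrib[symmetric] pprod_def[symmetric]
  by (intro limI tendsto_power pprod_tendsto)

section \<open>Generations as equivalence classes\<close>

lemma Chi_set_pow: "(Chi_set E ^^ n) W = {v. anc n v \<in> W}"
proof (induction n)
  case (Suc n)
  have "(Chi_set E ^^ Suc n) W = {v. par E v \<in> {v. anc n v \<in> W}}"
    by (auto simp: Suc Chi_set_def edge_iff)
  then show ?case by (simp only: mem_Collect_eq anc_par)
qed simp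

lemma Gen_iff: "v \<in> Gen E u \<longleftrightarrow> (\<exists>n. anc n v = anc n u)"
  by (simp add: Gen_def Chi_set_pow)

lemma anc_eq_mono: "anc n v = anc n u \<Longrightarrow> n \<le> m \<Longrightarrow> anc m v = anc m u"
  by (metis anc_anc le_add_diff_inverse2)

lemma Gen_refl: "u \<in> Gen E u"
  by (auto simp: Gen_iff)

lemma Gen_par_iff: "par E v \<in> Gen E (par E u) \<longleftrightarrow> v \<in> Gen E u"
  unfolding Gen_iff anc_par by (metis anc_eq_mono le_SucI order_refl)

lemma Gen_anc_iff: "anc n v \<in> Gen E (anc n u) \<longleftrightarrow> v \<in> Gen E u"
  by (induction n) (simp_all add: Gen_par_iff)

text \<open>Transitivity: two depths of agreement can be raised to their maximum, because ancestral
  lines stay together once they meet.\<close>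

lemma Gen_eq: "v \<in> Gen E u \<Longrightarrow> Gen E v = Gen E u"
  unfolding set_eq_iff Gen_iff by (metis anc_eq_mono nle_le)

text \<open>Supplies one depth for a whole finite set, so that a single power of \<open>S\<close>
  reaches all of it.\<close>

lemma Gen_finite_anc:
  assumes "finite F" "F \<subseteq> Gen E u"
  shows "\<exists>n. \<forall>v\<in>F. anc n v = anc n u"
  using assms
proof (induction F)
  case (insert w F)
  then obtain n m where "\<forall>v\<in>F. anc n v = anc n u" "anc m w = anc m u" by (auto simp: Gen_iff)
  then show ?case
    by (intro exI[of _ "max n m"]) (metis anc_eq_mono insert_iff max.cobounded1 max.cobounded2)
qed simp

section \<open>The vectors \<open>h u\<close>\<close>

text \<open>For a depth \<open>n\<close> shared by \<open>F\<close>, the vector \<open>?f\<close>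
  has entry \<open>pprod n v \<ge> p v\<close> at each \<open>v\<close> in \<open>F\<close>, and its
  norm is at most 1.\<close>

lemma sum_p_square_le:
  assumes "finite F" "F \<subseteq> Gen E u"
  shows "(\<Sum>v\<in>F. (p v)\<^sup>2) \<le> 1"
proof -
  obtain n where n: "\<And>v. v \<in> F \<Longrightarrow> anc n v = anc n u" using Gen_finite_anc[OF assms] by blast
  let ?f = "(S ^^ n) (ket (anc n u))"
  have "(\<Sum>v\<in>F. (p v)\<^sup>2) \<le> (\<Sum>v\<in>F. (cmod (Rep_ell2 ?f v))\<^sup>2)"
    using p_pos pprod_pos p_le_pprod
    by (intro sum_mono power_mono) (auto simp: S_pow_apply n Rep_ell2_ket less_imp_le norm_mult)
  also have "\<dots> \<le> (norm ?f)\<^sup>2"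
    by (rule has_sum_mono2[OF has_sum_finite[OF assms(1)] has_sum_norm_ell2]) auto
  also have "\<dots> \<le> 1"
    using norm_S_pow_le[of n "ket (anc n u)"] by (simp add: power_le_one)
  finally show ?thesis .
qed

definition h :: "'v \<Rightarrow> 'v ell2" where
  "h u = Abs_ell2 (\<lambda>v. if v \<in> Gen E u then p v else 0)"

lemma
  Rep_h: "Rep_ell2 (h u) v = (if v \<in> Gen E u then p v else 0)" and norm_h_le: "norm (h u) \<le> 1"
proof -
  let ?h = "\<lambda>v. complex_of_real (if v \<in> Gen E u then p v else 0)"
  have le: "(\<Sum>v\<in>F. (cmod (?h v))\<^sup>2) \<le> 1" if "finite F" for F
  proof -
    have "(\<Sum>v\<in>F. (cmod (?h v))\<^sup>2) = (\<Sum>v\<in>F \<inter> Gen E u. (p v)\<^sup>2)"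
      using that by (intro sum.mono_neutral_cong_right) auto
    also have "\<dots> \<le> 1" using that by (intro sum_p_square_le) auto
    finally show ?thesis .
  qed
  then have "Rep_ell2 (h u) = ?h"
    unfolding h_def by (intro Rep_Abs_ell2 square_summableI)
  then have R: "Rep_ell2 (h u) v = ?h v" for v by (simp only:)
  show "Rep_ell2 (h u) v = ?h v" by (rule R)
  show "norm (h u) \<le> 1" by (rule norm_ell2_le) (simp_all only: R le power_one zero_le_one)
qed

lemma h_nonzero: "h u \<noteq> 0"
  using Rep_h[of u u] p_pos[of u] Gen_refl[of u] by (auto simp: zero_ell2.rep_eq)

lemma h_expansion: "((\<lambda>v. p v *\<^sub>R ket v) has_sum h u) (Gen E u)"
proof -
  have "((\<lambda>v. (if v \<in> Gen E u then p v else 0) *\<^sub>R ket v) has_sum h u) UNIV"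
    using ket_expansion[of "h u"] by (simp only: Rep_h scaleR_ell2_scaleC)
  then show ?thesis
    by (rule has_sum_cong_neutral[THEN iffD1, rotated -1]) auto
qed

lemma h_vec_eq: "h_vec E lam u = h u"
  unfolding h_vec_def using h_expansion by (rule infsumI)

lemma a_coef_eq: "a_coef E lam u = (norm (h u))\<^sup>2"
  by (simp add: a_coef_def h_vec_eq)

lemma a_coef_has_sum:
  "((\<lambda>v. par_prod E (\<lambda>w. (lam w)\<^sup>2) v) has_sum a_coef E lam u) (Gen E u)"
  unfolding a_coef_eq par_prod_square using has_sum_norm_ell2[of "h u"]
  by (rule has_sum_cong_neutral[THEN iffD1, rotated -1]) (auto simp: Rep_h)

lemma a_coef_bounds: "a_coef E lam u \<in> {0<..1}"
  using h_nonzero norm_h_le by (auto simp: a_coef_eq power_le_one)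

lemma h_eq: "v \<in> Gen E u \<Longrightarrow> h v = h u"
  by (simp add: h_def Gen_eq)

text \<open>\<open>anc n\<close> respects generations in both directions, and \<open>p_split\<close>
  turns \<open>pprod n w * p (anc n w)\<close> into \<open>p w\<close>.\<close>

lemma S_pow_h: "(S ^^ n) (h (anc n v)) = h v"
  by (rule ell2_eqI) (simp add: S_pow_apply Rep_h Gen_anc_iff p_split[of _ n, symmetric] flip: of_real_mult)

lemma S_h_par: "S (h (par E v)) = h v"
  using S_pow_h[of 1 v] by simp

lemma cinner_h_disjoint:
  assumes "v \<notin> Gen E u"
  shows "cinner (h u) (h v) = 0"
proof -
  have "w \<notin> Gen E v" if "w \<in> Gen E u" for w
    using assms that Gen_eq Gen_refl by blast
  then have "Rep_ell2 (h u) w * cnj (Rep_ell2 (h v) w) = 0" for w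
    by (simp add: Rep_h)
  then show ?thesis unfolding cinner_def by (simp only: infsum_0_simp)
qed

text \<open>
  Both \<open>ket w\<close> and \<open>h w\<close> with \<open>w = anc n v\<close> are mapped by \<open>S ^^ n\<close> into the generation of \<open>v\<close>, the
  latter onto \<open>h v\<close>, and their distance tends to zero because the entry of \<open>h w\<close> at \<open>w\<close> tends
  to one while \<open>norm (h w) \<le> 1\<close>.
\<close>

lemma S_pow_adj_pow_ket_tendsto:
  "(\<lambda>n. (S ^^ n) ((adj S ^^ n) (ket v))) \<longlonglongrightarrow> p v *\<^sub>R h v"
proof -
  have bound: "(norm ((S ^^ n) (ket (anc n v)) - h v))\<^sup>2 \<le> 2 - 2 * p (anc n v)" for n
  proof -
    let ?w = "anc n v"
    have "norm ((S ^^ n) (ket ?w) - h v) = norm ((S ^^ n) (ket ?w - h ?w))"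
      using bounded_clinear_diff[OF bounded_clinear_funpow[OF bounded_clinear_S]] S_pow_h by metis
    also have "\<dots> \<le> norm (ket ?w - h ?w)" by (rule norm_S_pow_le)
    finally have "(norm ((S ^^ n) (ket ?w) - h v))\<^sup>2 \<le> (norm (ket ?w - h ?w))\<^sup>2"
      by (rule power_mono) simp
    also have "\<dots> = (norm (ket ?w))\<^sup>2 + (norm (h ?w))\<^sup>2 - 2 * inner (h ?w) (ket ?w)"
      by (simp only: power2_norm_eq_inner inner_diff_left inner_diff_right inner_commute)
    also have "inner (h ?w) (ket ?w) = p ?w"
      by (simp add: inner_ell2_def cinner_ket Rep_h Gen_refl)
    also have "(norm (h ?w))\<^sup>2 \<le> 1" by (simp add: power_le_one norm_h_le)
    finally show ?thesis by simp
  qed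
  have "(\<lambda>n. 2 - 2 * p (anc n v)) \<longlonglongrightarrow> 2 - 2 * 1"
    by (intro tendsto_intros p_anc_tendsto)
  then have "(\<lambda>n. 2 - 2 * p (anc n v)) \<longlonglongrightarrow> 0" by simp
  then have "(\<lambda>n. (norm ((S ^^ n) (ket (anc n v)) - h v))\<^sup>2) \<longlonglongrightarrow> 0"
    by (rule tendsto_sandwich[OF _ _ tendsto_const, rotated -1]) (auto simp: bound)
  then have "(\<lambda>n. (S ^^ n) (ket (anc n v))) \<longlonglongrightarrow> h v"
    by (rule tendsto_norm_square)
  \<comment> \<open>By \<open>adj_pow_ket\<close> the scalar left out so far is
    \<open>pprod n v\<close>; its limit supplies the factor \<open>p v\<close>.\<close>
  then have "(\<lambda>n. pprod n v *\<^sub>R (S ^^ n) (ket (anc n v))) \<longlonglongrightarrow> p v *\<^sub>R h v"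
    by (intro tendsto_intros pprod_tendsto)
  then show ?thesis
    by (simp add: adj_pow_ket bounded_clinear_scaleR[OF bounded_clinear_funpow[OF bounded_clinear_S]])
qed

end


section \<open>Levels\<close>

text \<open>Treats both model shifts at once: coordinates move along the injection
  \<open>\<sigma>\<close>, and the remaining places are filled with zeros.\<close>

lemma
  fixes T :: "'i ell2 \<Rightarrow> 'i ell2"
  assumes inj: "inj \<sigma>"
    and on: "\<And>x i. Rep_ell2 (T x) (\<sigma> i) = Rep_ell2 x i"
    and off: "\<And>x j. j \<notin> range \<sigma> \<Longrightarrow> Rep_ell2 (T x) j = 0"
  shows norm_index_shift: "norm (T x) = norm x"
    and bounded_clinear_index_shift: "bounded_clinear T"
proof -
  have norm: "norm (T x) = norm x" for x
  proof -
    have "((\<lambda>i. (cmod (Rep_ell2 x i))\<^sup>2) has_sum (norm (T x))\<^sup>2) UNIV \<longleftrightarrow>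
        ((\<lambda>j. (cmod (Rep_ell2 (T x) j))\<^sup>2) has_sum (norm (T x))\<^sup>2) (range \<sigma>)"
      using has_sum_reindex[OF inj, of "\<lambda>j. (cmod (Rep_ell2 (T x) j))\<^sup>2"] by (simp add: comp_def on)
    also have "\<dots> \<longleftrightarrow> ((\<lambda>j. (cmod (Rep_ell2 (T x) j))\<^sup>2) has_sum (norm (T x))\<^sup>2) UNIV"
      by (rule has_sum_cong_neutral) (auto simp: off)
    finally have "((\<lambda>i. (cmod (Rep_ell2 x i))\<^sup>2) has_sum (norm (T x))\<^sup>2) UNIV"
      using has_sum_norm_ell2 by blast
    then have "(norm (T x))\<^sup>2 = (norm x)\<^sup>2" using has_sum_norm_ell2 has_sum_unique by blast
    then show ?thesis by simp
  qed
  then show "norm (T x) = norm x" .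
  have "Rep_ell2 (T (x + y)) j = Rep_ell2 (T x + T y) j"
    "Rep_ell2 (T (c *\<^sub>C x)) j = Rep_ell2 (c *\<^sub>C T x) j" for x y c j
    by (cases "j \<in> range \<sigma>"; force simp: on off plus_ell2.rep_eq scaleC.rep_eq)+
  then show "bounded_clinear T"
    by (intro bounded_clinearI[where K = 1]) (simp_all add: ell2_eqI norm)
qed

text \<open>\<open>lev\<close> labels the generations, \<open>\<sigma>\<close> is the map that
  \<open>par\<close> induces on labels, and \<open>T\<close> is the model shift along it. The two
  instances are the integers, where \<open>\<sigma>\<close> is onto, and the naturals, where 0
  labels the last level.\<close>

locale levelled_shift = nondecaying_shift E lam S
  for E :: "('v \<times> 'v) set" and lam S +
  fixes lev :: "'v \<Rightarrow> 'i" and \<sigma> :: "'i \<Rightarrow> 'i" and T :: "'i ell2 \<Rightarrow> 'i ell2"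
  assumes surj_lev: "surj lev"
    and lev_eq_iff: "lev u = lev v \<longleftrightarrow> u \<in> Gen E v"
    and lev_par: "lev (par E v) = \<sigma> (lev v)"
    and T_on: "Rep_ell2 (T x) (\<sigma> i) = Rep_ell2 x i"
    and T_off: "j \<notin> range \<sigma> \<Longrightarrow> Rep_ell2 (T x) j = 0"
begin

lemma lev_cases: obtains v where "i = lev v"
  using surj_lev by (metis surjD)

lemma inj_succ: "inj \<sigma>"
proof (rule injI)
  fix i j assume "\<sigma> i = \<sigma> j"
  moreover obtain u v where "i = lev u" "j = lev v" by (metis lev_cases)
  ultimately show "i = j" by (metis lev_par lev_eq_iff Gen_par_iff)
qed

text \<open>\<open>inv lev i\<close> picks a representative vertex; by \<open>h_inv_lev\<close> the
  choice does not matter.\<close>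

definition a :: "'i \<Rightarrow> real" where
  "a i = a_coef E lam (inv lev i)"

definition e :: "'i \<Rightarrow> 'v ell2" where
  "e i = (1 / sqrt (a i)) *\<^sub>R h (inv lev i)"

lemma h_inv_lev: "h (inv lev (lev v)) = h v"
  by (rule h_eq) (simp add: surj_f_inv_f[OF surj_lev] flip: lev_eq_iff)

lemma a_lev: "a (lev v) = a_coef E lam v"
  by (simp add: a_def a_coef_eq h_inv_lev)

lemma e_lev: "e (lev v) = (1 / sqrt (a_coef E lam v)) *\<^sub>R h v"
  by (simp add: e_def a_lev h_inv_lev)

lemma a_range: "a i \<in> {0<..1}"
  by (simp only: a_def a_coef_bounds)

sublocale orthonormal_family e
proof
  fix i j
  obtain u v where i: "i = lev u" and j: "j = lev v" by (metis lev_cases)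
  show "cinner (e i) (e j) = (if i = j then 1 else 0)"
  proof (cases "i = j")
    case True
    have "cinner (e i) (e j) = complex_of_real ((1 / sqrt (a i)) * ((1 / sqrt (a i)) * a i))"
      unfolding True[symmetric] i e_lev cinner_scaleR_left cinner_scaleR_right a_lev
      by (simp only: cinner_self a_coef_eq of_real_mult)
    also have "(1 / sqrt (a i)) * ((1 / sqrt (a i)) * a i) = 1"
      using a_range[of i] by (simp add: real_div_sqrt)
    finally show ?thesis using True by simp
  next
    case False
    then have "v \<notin> Gen E u" using lev_eq_iff i j by metis
    then show ?thesis
      using False by (simp add: i j e_lev cinner_scaleR_left cinner_scaleR_right cinner_h_disjoint)
  qed
qed

lemma h_conv_e: "h v = sqrt (a (lev v)) *\<^sub>R e (lev v)"
  using a_range[of "lev v"] by (simp add: e_lev a_lev)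

lemma a_range': "a i \<in> {0..1}" and sqrt_a_range: "sqrt (a i) \<in> {0..1}"
  using a_range[of i] by auto

text \<open>The normalisation of \<open>e\<close> cancels against \<open>sqrt (a i)\<close>, leaving
  inner products with the unnormalised \<open>h v\<close>. Both sides of \<open>intertwine\<close>
  are computed this way.\<close>

lemma Rep_diag_analysis: "Rep_ell2 (diag (\<lambda>i. sqrt (a i)) (analysis e f)) (lev v) = cinner f (h v)"
  by (simp add: Rep_diag[OF sqrt_a_range] Rep_analysis h_conv_e cinner_scaleR_right)

text \<open>Reproduces the limit in \<open>S_pow_adj_pow_ket_tendsto\<close>, so that
  \<open>diag_op a\<close> and \<open>A_star S\<close> agree on basis vectors.\<close>

lemma diag_op_ket: "diag_op a (ket v) = p v *\<^sub>R h v"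
proof -
  have "diag a (analysis e (ket v)) = (p v * sqrt (a (lev v))) *\<^sub>R ket (lev v)"
  proof (rule ell2_eqI)
    fix i
    obtain u where i: "i = lev u" by (rule lev_cases)
    have "Rep_ell2 (analysis e (ket v)) i = (1 / sqrt (a i)) * (if v \<in> Gen E u then p v else 0)"
      by (simp add: Rep_analysis i e_lev a_lev cinner_scaleR_right cinner_ket_left Rep_h)
    moreover have "v \<in> Gen E u \<longleftrightarrow> i = lev v" using lev_eq_iff i by metis
    ultimately have "Rep_ell2 (diag a (analysis e (ket v))) i
        = complex_of_real (a i / sqrt (a i) * (if i = lev v then p v else 0))"
      by (simp add: Rep_diag[of a, OF a_range'])
    also have "a i / sqrt (a i) = sqrt (a i)"
      using a_range[of i] by (simp add: real_div_sqrt)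
    finally show "Rep_ell2 (diag a (analysis e (ket v))) i
        = Rep_ell2 ((p v * sqrt (a (lev v))) *\<^sub>R ket (lev v)) i"
      by (simp add: Rep_ell2_scaleR Rep_ell2_ket)
  qed
  then show ?thesis
    by (simp add: diag_op_def bounded_clinear_scaleR[OF bounded_clinear_synthesis] synthesis_ket h_conv_e)
qed

text \<open>Convergence on basis vectors extends to every \<open>f\<close> because the differences
  are bounded uniformly by \<open>1 + K\<close>, with 1 from the contractions and \<open>K\<close>
  from \<open>diag_op a\<close>.\<close>

lemma A_star_eq: "A_star S = diag_op a"
proof
  fix f
  have lin: "bounded_clinear (\<lambda>f. (S ^^ n) ((adj S ^^ n) f) - diag_op a f)" for n
    by (rule bounded_clinear_minus[OF bounded_clinear_compose[OF bounded_clinear_funpow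
          bounded_clinear_funpow]])
      (simp_all add: bounded_clinear_S bounded_clinear_adj bounded_clinear_diag_op[of a, OF a_range'])
  obtain K where K: "\<And>f. norm (diag_op a f) \<le> K * norm f"
    using bounded_clinear_bound[OF bounded_clinear_diag_op[of a, OF a_range']] by auto
  have "(\<lambda>n. (S ^^ n) ((adj S ^^ n) f) - diag_op a f) \<longlonglongrightarrow> 0"
  proof (rule strong_limit_ket[OF lin])
    show "norm ((S ^^ n) ((adj S ^^ n) f) - diag_op a f) \<le> (1 + K) * norm f" for n f
      using norm_triangle_ineq4[of "(S ^^ n) ((adj S ^^ n) f)" "diag_op a f"] K[of f]
        norm_S_pow_le[of n "(adj S ^^ n) f"] norm_adj_pow_le[of n f]
      by (simp add: distrib_right)
    show "(\<lambda>n. (S ^^ n) ((adj S ^^ n) (ket v)) - diag_op a (ket v)) \<longlonglongrightarrow> 0" for v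
      unfolding diag_op_ket using S_pow_adj_pow_ket_tendsto by (rule LIM_zero)
  qed
  then show "A_star S f = diag_op a f"
    unfolding A_star_def by (rule limI[OF LIM_zero_cancel])
qed

sublocale diagonal_asymptote e S a T
proof
  show "a i \<in> {0<..1}" for i by (rule a_range)
  show "A_star S = diag_op a" by (rule A_star_eq)
  show "bounded_clinear T" by (rule bounded_clinear_index_shift[OF inj_succ T_on T_off])
  show "norm (T x) = norm x" for x by (rule norm_index_shift[OF inj_succ T_on T_off])
  fix f
  show "diag (\<lambda>i. sqrt (a i)) (analysis e (adj S f)) = T (diag (\<lambda>i. sqrt (a i)) (analysis e f))"
  proof (rule ell2_eqI)
    fix i
    obtain w where w: "i = lev w" by (rule lev_cases)
    have lhs: "Rep_ell2 (diag (\<lambda>i. sqrt (a i)) (analysis e (adj S f))) i = cinner f (S (h w))"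
      by (simp add: w Rep_diag_analysis adj_eq_hadj cinner_hadj_left bounded_clinear_S)
    show "Rep_ell2 (diag (\<lambda>i. sqrt (a i)) (analysis e (adj S f))) i
      = Rep_ell2 (T (diag (\<lambda>i. sqrt (a i)) (analysis e f))) i"
    proof (cases "i \<in> range \<sigma>")
      case True
      \<comment> \<open>Some \<open>v\<close> has its parent on the level of \<open>w\<close>, so
        \<open>h w\<close> is \<open>h (par E v)\<close> and \<open>S\<close> carries it to
        \<open>h v\<close>.\<close>
      then obtain v where v: "i = \<sigma> (lev v)" by (metis rangeE lev_cases)
      then have "w \<in> Gen E (par E v)" using w lev_par lev_eq_iff by metis
      then have "S (h w) = h v" by (simp add: h_eq S_h_par)
      then show ?thesis unfolding lhs by (simp add: v T_on Rep_diag_analysis)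
    next
      case False
      \<comment> \<open>This is a last level: no vertex has its parent there, so \<open>S\<close>
        annihilates \<open>h w\<close>.\<close>
      then have "par E v \<notin> Gen E w" for v using w lev_par lev_eq_iff by (metis rangeI)
      then have "S (h w) = 0"
        by (intro ell2_eqI) (simp add: S_apply Rep_h zero_ell2.rep_eq)
      then show ?thesis unfolding lhs by (simp add: T_off False)
    qed
  qed
qed

lemma h_conv_synthesis: "h v = synthesis (sqrt (a (lev v)) *\<^sub>R ket (lev v))"
  by (simp add: bounded_clinear_scaleR[OF bounded_clinear_synthesis] synthesis_ket h_conv_e)

lemma h_in_orth_compl: "h v \<in> orth_compl (H0_star S)"
  unfolding orth_compl_H0_star by (simp only: h_conv_synthesis rangeI)

lemma T_ket: "T (ket i) = ket (\<sigma> i)"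
proof (rule ell2_eqI)
  fix j
  show "Rep_ell2 (T (ket i)) j = Rep_ell2 (ket (\<sigma> i)) j"
    using inj_succ by (cases "j \<in> range \<sigma>") (auto simp: T_on T_off Rep_ell2_ket inj_eq)
qed

lemma U_star_h:
  "U_star S (h v) = (sqrt (a_coef E lam v) / sqrt (a_coef E lam (par E v))) *\<^sub>R h (par E v)"
proof -
  have "U_star S (h v) = synthesis (T (sqrt (a (lev v)) *\<^sub>R ket (lev v)))"
    by (simp only: h_conv_synthesis U_star_synthesis)
  also have "\<dots> = sqrt (a (lev v)) *\<^sub>R e (lev (par E v))"
    by (simp add: bounded_clinear_scaleR[OF bounded_clinear_synthesis]
        bounded_clinear_scaleR[OF T(1)] T_ket synthesis_ket lev_par)
  finally show ?thesis by (simp add: e_lev a_lev)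
qed

end

section \<open>Grading the tree by integer levels\<close>

context nondecaying_shift
begin

lemma anc_cycle: "anc k w = w \<Longrightarrow> k = 0"
proof (rule ccontr)
  assume w: "anc k w = w" and "k \<noteq> 0"
  have "(anc n v, v) \<in> E\<^sup>+" if "n > 0" for n v
    using that
  proof (induction n)
    case (Suc n)
    then show ?case
      using par_edge by (cases "n = 0") (auto intro: trancl_into_trancl2)
  qed simp
  with w \<open>k \<noteq> 0\<close> have "(w, w) \<in> E\<^sup>+" by (metis neq0_conv)
  then show False using tree by (simp add: directed_tree_def acyclic_def)
qed

lemma anc_inj: "anc m v = anc n v \<Longrightarrow> m = n"
proof (induction m n rule: linorder_wlog)
  case (le m n)
  then have "anc (n - m) (anc m v) = anc m v" unfolding anc_anc by simp
  then show ?case using anc_cycle le(1) by fastforce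
qed simp

text \<open>Induction along an undirected path: a step down to a child lengthens the ancestral line
  of the endpoint by one, a step up is matched by one more step from \<open>u\<close>.\<close>

lemma common_ancestor: "\<exists>n m. anc n u = anc m v"
proof -
  have "(u, v) \<in> (E \<union> E\<inverse>)\<^sup>*" using tree by (simp add: directed_tree_def)
  then show ?thesis
  proof (induction rule: rtrancl_induct)
    case (step v w)
    then obtain n m where nm: "anc n u = anc m v" by blast
    show ?case
    proof (cases "v = par E w")
      case True
      then show ?thesis using nm anc_par by metis
    next
      case False
      then have "w = par E v" using step.hyps(2) by (auto simp: edge_iff)
      then have "anc (Suc n) u = anc m w" using nm by (simp add: anc_par)
      then show ?thesis by blast
    qed
  qed blast
qed

lemma ex_level: "\<exists>lev :: 'v \<Rightarrow> int. \<forall>v. lev (par E v) = lev v + 1"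
proof -
  fix v\<^sub>0 :: 'v
  \<comment> \<open>\<open>k\<close> is the level of \<open>v\<close> relative to the base vertex
    \<open>v\<^sub>0\<close>, measured through a common ancestor. It grows towards parents, and by
    \<open>anc_inj\<close> it does not depend on the ancestor chosen.\<close>
  define Q where "Q v k \<longleftrightarrow> (\<exists>n m. anc n v = anc m v\<^sub>0 \<and> k = int m - int n)" for v k
  have unique: "k = k'" if "Q v k" "Q v k'" for v k k'
  proof -
    from that obtain n m n' m' where
      *: "anc n v = anc m v\<^sub>0" "k = int m - int n" "anc n' v = anc m' v\<^sub>0" "k' = int m' - int n'"
      unfolding Q_def by blast
    \<comment> \<open>Both sides are the ancestor of \<open>v\<close> at height
      \<open>n + n'\<close>.\<close>
    have "anc (n' + m) v\<^sub>0 = anc (n + m') v\<^sub>0"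
      by (metis * anc_anc add.commute)
    then show ?thesis using anc_inj * by fastforce
  qed
  have ex: "\<exists>k. Q v k" for v unfolding Q_def using common_ancestor by blast
  have par: "Q (par E v) (k + 1)" if "Q v k" for v k
  proof -
    from that obtain n m where "anc n v = anc m v\<^sub>0" "k = int m - int n" unfolding Q_def by blast
    then have "anc n (par E v) = anc (Suc m) v\<^sub>0" "k + 1 = int (Suc m) - int n"
      by (simp_all add: anc_par)
    then show ?thesis unfolding Q_def by blast
  qed
  have "(THE k. Q (par E v) k) = (THE k. Q v k) + 1" for v
  proof -
    obtain k where "Q v k" using ex by blast
    then have "(THE k. Q v k) = k" "(THE k. Q (par E v) k) = k + 1"
      using unique par by (auto intro!: the_equality)
    then show ?thesis by simp
  qed
  then show ?thesis by (intro exI[of _ "\<lambda>v. THE k. Q v k"]) simp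
qed

context
  fixes lev :: "'v \<Rightarrow> int"
  assumes lev_par: "lev (par E v) = lev v + 1"
begin

lemma lev_anc: "lev (anc n v) = lev v + int n"
  by (induction n) (simp_all add: lev_par)

text \<open>Equal levels force a common ancestor to be reached in equally many steps from both
  sides.\<close>

lemma int_lev_eq_iff: "lev u = lev v \<longleftrightarrow> u \<in> Gen E v"
proof
  assume eq: "lev u = lev v"
  obtain n m where nm: "anc n u = anc m v" using common_ancestor by blast
  then have "lev u + int n = lev v + int m" using lev_anc by metis
  then show "u \<in> Gen E v" using eq nm by (auto simp: Gen_iff)
next
  assume "u \<in> Gen E v"
  then obtain n where "anc n u = anc n v" by (auto simp: Gen_iff)
  then have "lev u + int n = lev v + int n" using lev_anc by metis
  then show "lev u = lev v" by simp
qed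

text \<open>Levels grow towards parents, so children lie one lower and a last level is one with
  nothing at \<open>lev u - 1\<close>.\<close>

lemma Chi_set_Gen: "Chi_set E (Gen E u) = {v. lev v + 1 = lev u}"
  by (auto simp: Chi_set_def edge_iff simp flip: int_lev_eq_iff lev_par)

lemma levelled_shift_int:
  assumes "\<nexists>u. Chi_set E (Gen E u) = {}"
  shows "levelled_shift E lam S lev (\<lambda>i. i + 1) bilateral_shift"
proof
  have down: "\<exists>v. lev v = lev u - int n" for n u
  proof (induction n)
    case (Suc n)
    then obtain v where v: "lev v = lev u - int n" by blast
    obtain w where "lev w + 1 = lev v" using assms Chi_set_Gen[of v] by auto
    with v show ?case by (intro exI[of _ w]) simp
  qed auto
  show "surj lev"
  proof (rule surjI)
    fix k
    fix u :: 'v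
    show "lev (SOME v. lev v = k) = k"
    proof (rule someI_ex[of "\<lambda>v. lev v = k"])
      \<comment> \<open>Levels up to \<open>lev u\<close> come from \<open>down\<close>, as every
        generation has children; those above come from ancestors of \<open>u\<close>.\<close>
      show "\<exists>v. lev v = k"
        using down[of u "nat (lev u - k)"] lev_anc[of "nat (k - lev u)" u]
        by (cases "k \<le> lev u") auto
    qed
  qed
qed (simp_all add: int_lev_eq_iff lev_par bilateral_shift.rep_eq surj_plus_right)

text \<open>Levels are counted upwards from the last one, which gets index 0.\<close>

lemma levelled_shift_nat:
  assumes last: "Chi_set E (Gen E u\<^sub>0) = {}"
  shows "levelled_shift E lam S (\<lambda>v. nat (lev v - lev u\<^sub>0)) Suc unilateral_shift"
proof
  have ge: "lev u\<^sub>0 \<le> lev v" for v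
  proof (rule ccontr)
    assume "\<not> lev u\<^sub>0 \<le> lev v"
    \<comment> \<open>From a vertex below the last level this many steps up end exactly one level
      below \<open>u\<^sub>0\<close>, hence in the empty set of children.\<close>
    then have "lev (anc (nat (lev u\<^sub>0 - lev v - 1)) v) + 1 = lev u\<^sub>0" by (simp add: lev_anc)
    then show False using last by (auto simp: Chi_set_Gen)
  qed
  show "surj (\<lambda>v. nat (lev v - lev u\<^sub>0))"
    by (rule surjI[of _ "\<lambda>n. anc n u\<^sub>0"]) (simp add: lev_anc)
  show "nat (lev u - lev u\<^sub>0) = nat (lev v - lev u\<^sub>0) \<longleftrightarrow> u \<in> Gen E v" for u v
    using ge[of u] ge[of v] by (auto simp flip: int_lev_eq_iff)
  show "nat (lev (par E v) - lev u\<^sub>0) = Suc (nat (lev v - lev u\<^sub>0))" for v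
    using ge[of v] by (simp add: lev_par)
  show "j \<notin> range Suc \<Longrightarrow> Rep_ell2 (unilateral_shift x) j = 0" for x j
    by (cases j) (auto simp: unilateral_shift.rep_eq)
qed (simp_all add: unilateral_shift.rep_eq)

end

end

theorem theorem4p3:
  fixes E :: "('v \<times> 'v) set" and lam :: "'v \<Rightarrow> real" and S :: "'v ell2 \<Rightarrow> 'v ell2"
  assumes "directed_tree E"
    and "shift_weights E lam"
    and "is_weighted_shift E lam S"
    and "contraction S"
    and "\<not> class_C_dot_0 S"
  shows
    "(\<nexists>r. is_root E r) \<and>
     (\<forall>u. (\<lambda>v. par_prod E lam v *\<^sub>R ket v) summable_on Gen E u \<and>
          h_vec E lam u \<noteq> 0 \<and>
          ((\<lambda>v. par_prod E (\<lambda>w. (lam w)\<^sup>2) v) has_sum a_coef E lam u) (Gen E u) \<and>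
          a_coef E lam u \<in> {0<..1} \<and>
          h_vec E lam u \<in> orth_compl (H0_star S) \<and>
          U_star S (h_vec E lam u) =
            (sqrt (a_coef E lam u) / sqrt (a_coef E lam (par E u))) *\<^sub>R h_vec E lam (par E u)) \<and>
     ((\<exists>u. Chi_set E (Gen E u) = {}) \<longrightarrow>
        unitarily_equivalent (orth_compl (H0_star S)) (U_star S) UNIV unilateral_shift) \<and>
     ((\<nexists>u. Chi_set E (Gen E u) = {}) \<longrightarrow>
        unitarily_equivalent (orth_compl (H0_star S)) (U_star S) UNIV bilateral_shift)"
proof -
  interpret nondecaying_shift E lam S
    by unfold_locales (use assms in auto)
  obtain lev :: "'v \<Rightarrow> int" where lev: "\<And>v. lev (par E v) = lev v + 1"
    using ex_level by blast
  \<comment> \<open>The formula does not mention levels, but its proof runs in a levelled model;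
    whichever case holds supplies one.\<close>
  have U: "h u \<in> orth_compl (H0_star S) \<and>
      U_star S (h u) = (sqrt (a_coef E lam u) / sqrt (a_coef E lam (par E u))) *\<^sub>R h (par E u)" for u
  proof (cases "\<exists>u. Chi_set E (Gen E u) = {}")
    case True
    then obtain u\<^sub>0 where "Chi_set E (Gen E u\<^sub>0) = {}" by blast
    note L = levelled_shift_nat[of lev, OF lev this]
    show ?thesis using levelled_shift.h_in_orth_compl[OF L] levelled_shift.U_star_h[OF L] by blast
  next
    case False
    note L = levelled_shift_int[of lev, OF lev False]
    show ?thesis using levelled_shift.h_in_orth_compl[OF L] levelled_shift.U_star_h[OF L] by blast
  qed
  have uni: "unitarily_equivalent (orth_compl (H0_star S)) (U_star S) UNIV unilateral_shift"
    if "\<exists>u. Chi_set E (Gen E u) = {}"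
  proof -
    from that obtain u\<^sub>0 where "Chi_set E (Gen E u\<^sub>0) = {}" by blast
    then interpret levelled_shift E lam S "\<lambda>v. nat (lev v - lev u\<^sub>0)" Suc unilateral_shift
      by (rule levelled_shift_nat[of lev, OF lev])
    show ?thesis by (rule unitarily_equivalent_U_star)
  qed
  have bi: "unitarily_equivalent (orth_compl (H0_star S)) (U_star S) UNIV bilateral_shift"
    if "\<nexists>u. Chi_set E (Gen E u) = {}"
  proof -
    interpret levelled_shift E lam S lev "\<lambda>i. i + 1" bilateral_shift
      by (rule levelled_shift_int[of lev, OF lev that])
    show ?thesis by (rule unitarily_equivalent_U_star)
  qed
  have "(\<lambda>v. p v *\<^sub>R ket v) summable_on Gen E u" for u
    using h_expansion by (rule has_sum_imp_summable)
  then show ?thesis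
    using no_root h_nonzero a_coef_has_sum a_coef_bounds U uni bi by (simp only: h_vec_eq) blast
qed

end
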